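(* For $n\ge 1$ and $\sigma\in\{132,213\}$, the number $t_n(\sigma)$ of shallow permutations in $S_n$ that avoid $\sigma$ equals $F_{2n-1}$.
   Context: For $\pi\in S_n$: $D(\pi)=\sum_{i}|\pi_i-i|$, $I(\pi)$ is the number of inversions, $T(\pi)=n-\mathrm{cyc}(\pi)$ with $\mathrm{cyc}$ the number of cycles in the disjoint cycle decomposition; $\pi$ is shallow if $I(\pi)+T(\pi)=D(\pi)$. A permutation $\pi$ avoids a pattern $\sigma\in S_k$ if no subsequence of $\pi$ of length $k$ has the same relative order as $\sigma$. $F_m$ denotes the Fibonacci numbers with $F_1=F_2=1$, $F_{m}=F_{m-1}+F_{m-2}$. *)

theory Defs
  imports "HOL-Combinatorics.Permutations" "HOL-Combinatorics.Orbits" "HOL-Number_Theory.Fib"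
begin

(* A permutation pi in S_n is a function nat => nat with pi permutes {1..n};
   pi_i is pi i for i in {1..n}. *)

definition total_disp :: "nat \<Rightarrow> (nat \<Rightarrow> nat) \<Rightarrow> nat" where
  "total_disp n p = (\<Sum>i=1..n. nat \<bar>int (p i) - int i\<bar>)"

definition inversions :: "nat \<Rightarrow> (nat \<Rightarrow> nat) \<Rightarrow> nat" where
  "inversions n p = card {(i, j). i \<in> {1..n} \<and> j \<in> {1..n} \<and> i < j \<and> p i > p j}"

definition num_cycles :: "nat \<Rightarrow> (nat \<Rightarrow> nat) \<Rightarrow> nat" where
  "num_cycles n p = card ((\<lambda>i. orbit p i) ` {1..n})"

definition depth_T :: "nat \<Rightarrow> (nat \<Rightarrow> nat) \<Rightarrow> nat" where
  "depth_T n p = n - num_cycles n p"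

definition shallow :: "nat \<Rightarrow> (nat \<Rightarrow> nat) \<Rightarrow> bool" where
  "shallow n p \<longleftrightarrow> inversions n p + depth_T n p = total_disp n p"

definition contains :: "nat \<Rightarrow> (nat \<Rightarrow> nat) \<Rightarrow> nat list \<Rightarrow> bool" where
  "contains n p sigma \<longleftrightarrow> (\<exists>idx :: nat \<Rightarrow> nat.
      strict_mono_on {0..<length sigma} idx \<and>
      (\<forall>a<length sigma. idx a \<in> {1..n}) \<and>
      (\<forall>a<length sigma. \<forall>b<length sigma.
          p (idx a) < p (idx b) \<longleftrightarrow> sigma ! a < sigma ! b))"

definition avoids :: "nat \<Rightarrow> (nat \<Rightarrow> nat) \<Rightarrow> nat list \<Rightarrow> bool" where
  "avoids n p sigma \<longleftrightarrow> \<not> contains n p sigma"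

end

theory Submission
  imports Defs
begin

text \<open>
  Let \<open>excess = D - I - T\<close>. Undoing the maximum of \<open>\<pi> \<in> S\<^sub>n\<close>, that is passing to
  \<open>\<rho> = (\<pi>\<^sub>n n) \<pi>\<close>, which fixes \<open>n\<close>, lowers the excess by \<open>2 min(L, R)\<close>, where \<open>L\<close> counts the larger
  entries to the left and \<open>R\<close> the smaller entries to the right of the relocated entry \<open>\<pi>\<^sub>n\<close> of \<open>\<rho>\<close>;
  undoing the minimum behaves in the same way. Hence the excess is nonnegative, and a permutation
  is shallow iff \<open>\<rho>\<close> is shallow and \<open>min(L, R) = 0\<close>.

  In a 132-avoider every entry before \<open>n\<close> exceeds every entry after it, so shallowness forces
  \<open>\<pi>\<^sub>n = n\<close>, \<open>\<pi>\<^sub>1 = n\<close> or \<open>\<pi>\<^sub>n = 1\<close>. Taking inverses exchanges the last two cases. With \<open>a\<^sub>n\<close> the number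
  of shallow 132-avoiders and \<open>c\<^sub>n\<close> the number of those with \<open>\<pi>\<^sub>n = 1\<close>, this gives
  \<open>a\<^sub>n = a\<^sub>n\<^sub>-\<^sub>1 + 2 c\<^sub>n - a\<^sub>n\<^sub>-\<^sub>2\<close>. If \<open>\<pi>\<^sub>n = 1\<close>, then undoing both extremes shows that \<open>n\<close> is in the
  first position (\<open>a\<^sub>n\<^sub>-\<^sub>2\<close> cases), in the last but one (\<open>c\<^sub>n\<^sub>-\<^sub>1\<close> cases), or else \<open>\<pi>\<^sub>1 = n - 1\<close>
  (\<open>a\<^sub>n\<^sub>-\<^sub>2 - a\<^sub>n\<^sub>-\<^sub>3\<close> cases). Reverse-complement turns 132 into 213.
\<close>

subsection \<open>The excess under transpositions\<close>

definition inv_pairs :: "nat set \<Rightarrow> (nat \<Rightarrow> nat) \<Rightarrow> (nat \<times> nat) set" where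
  "inv_pairs S p = {(i, j). i \<in> S \<and> j \<in> S \<and> i < j \<and> p i > p j}"

definition excess :: "nat set \<Rightarrow> (nat \<Rightarrow> nat) \<Rightarrow> int" where
  "excess S p = (\<Sum>i\<in>S. \<bar>int (p i) - int i\<bar>) - int (card (inv_pairs S p))
     - (int (card S) - int (card (orbit p ` S)))"

definition larger_left :: "nat set \<Rightarrow> (nat \<Rightarrow> nat) \<Rightarrow> nat \<Rightarrow> nat set" where
  "larger_left S p j = {i \<in> S. i < j \<and> p i > p j}"

definition smaller_right :: "nat set \<Rightarrow> (nat \<Rightarrow> nat) \<Rightarrow> nat \<Rightarrow> nat set" where
  "smaller_right S p j = {i \<in> S. i > j \<and> p i < p j}"

lemma shallow_iff_excess: "shallow n p \<longleftrightarrow> excess {1..n} p = 0"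
proof -
  \<comment> \<open>This bound makes the natural-number subtraction in \<open>depth_T\<close>
    exact.\<close>
  have "num_cycles n p \<le> n"
    unfolding num_cycles_def using card_image_le[of "{1..n}" "orbit p"] by simp
  then have "int (inversions n p + depth_T n p) =
      int (inversions n p) + (int n - int (num_cycles n p))"
    by (simp add: depth_T_def of_nat_diff)
  moreover have "excess {1..n} p =
      int (total_disp n p) - int (inversions n p) - (int n - int (num_cycles n p))"
    by (simp add: excess_def total_disp_def inversions_def inv_pairs_def num_cycles_def)
  ultimately show ?thesis unfolding shallow_def by linarith
qed

text \<open>The indicator form lets the rows and columns of two swapped positions be split off from
  an otherwise unchanged double sum.\<close>

lemma card_inv_pairs:
  assumes "finite S"
  shows "int (card (inv_pairs S p)) = (\<Sum>i\<in>S. \<Sum>j\<in>S. of_bool (i < j \<and> p j < p i))"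
proof -
  have "inv_pairs S p = (SIGMA i:S. {j\<in>S. i < j \<and> p j < p i})"
    by (auto simp: inv_pairs_def)
  moreover have "(\<Sum>j\<in>S. of_bool (i < j \<and> p j < p i)) = int (card {j\<in>S. i < j \<and> p j < p i})" for i
    using assms by (simp add: sum.If_cases of_bool_def Int_def)
  ultimately show ?thesis using assms by (simp add: card_SigmaI)
qed

lemma sum_sum_split_two:
  fixes g :: "'a \<Rightarrow> 'a \<Rightarrow> int"
  assumes "finite A" "j \<notin> A" "k \<notin> A" "j \<noteq> k"
  shows "(\<Sum>a\<in>insert j (insert k A). \<Sum>b\<in>insert j (insert k A). g a b) =
    (\<Sum>a\<in>A. \<Sum>b\<in>A. g a b) + (\<Sum>i\<in>A. g i j + g j i + g i k + g k i)
      + g j k + g k j + g j j + g k k"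
  using assms by (simp add: sum.distrib algebra_simps)

text \<open>The swap creates the inversion \<open>(j, k)\<close>. A third position between
  \<open>j\<close> and \<open>k\<close> whose value is also between \<open>q j\<close> and
  \<open>q k\<close> gains an inversion with each of the two; for any other position the number of
  inversions with \<open>j\<close> and \<open>k\<close> together is unchanged.\<close>

lemma card_inv_pairs_transpose:
  assumes fin: "finite S" and jk: "j \<in> S" "k \<in> S" "j < k" and inj: "inj_on q S" and less: "q j < q k"
  shows "int (card (inv_pairs S (q \<circ> transpose j k))) =
    int (card (inv_pairs S q)) + 1 + 2 * int (card {i \<in> S. j < i \<and> i < k \<and> q j < q i \<and> q i < q k})"
proof -
  define A where "A = S - {j, k}"
  have S: "S = insert j (insert k A)" and A: "finite A" "j \<notin> A" "k \<notin> A" "j \<noteq> k"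
    using fin jk by (auto simp: A_def)
  define p where "p = q \<circ> transpose j k"
  have p: "p j = q k" "p k = q j" "\<And>i. i \<in> A \<Longrightarrow> p i = q i"
    using A by (auto simp: p_def transpose_def)
  define g :: "(nat \<Rightarrow> nat) \<Rightarrow> nat \<Rightarrow> nat \<Rightarrow> int" where "g = (\<lambda>f a b. of_bool (a < b \<and> f b < f a))"
  have expand: "int (card (inv_pairs S f)) = (\<Sum>a\<in>A. \<Sum>b\<in>A. g f a b)
      + (\<Sum>i\<in>A. g f i j + g f j i + g f i k + g f k i) + g f j k + g f k j + g f j j + g f k k" for f
    using card_inv_pairs[OF fin, of f] sum_sum_split_two[OF A, of "g f"]
    unfolding S by (simp only: g_def)
  have "(\<Sum>a\<in>A. \<Sum>b\<in>A. g p a b) = (\<Sum>a\<in>A. \<Sum>b\<in>A. g q a b)"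
    by (intro sum.cong refl) (simp add: g_def p)
  moreover have "g p i j + g p j i + g p i k + g p k i =
      (g q i j + g q j i + g q i k + g q k i) + 2 * of_bool (j < i \<and> i < k \<and> q j < q i \<and> q i < q k)"
    if i: "i \<in> A" for i
  proof -
    have "q i \<noteq> q j" "q i \<noteq> q k" "i \<noteq> j" "i \<noteq> k" using i A inj by (auto simp: S inj_on_def)
    then show ?thesis using less jk(3) i by (auto simp: g_def p)
  qed
  then have "(\<Sum>i\<in>A. g p i j + g p j i + g p i k + g p k i) =
      (\<Sum>i\<in>A. g q i j + g q j i + g q i k + g q k i)
      + 2 * (\<Sum>i\<in>A. of_bool (j < i \<and> i < k \<and> q j < q i \<and> q i < q k))"
    by (simp add: sum.distrib sum_distrib_left)
  moreover have "(\<Sum>i\<in>A. of_bool (j < i \<and> i < k \<and> q j < q i \<and> q i < q k)) =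
      int (card {i \<in> S. j < i \<and> i < k \<and> q j < q i \<and> q i < q k})"
  proof -
    have "{i \<in> S. j < i \<and> i < k \<and> q j < q i \<and> q i < q k} =
        {i \<in> A. j < i \<and> i < k \<and> q j < q i \<and> q i < q k}" by (auto simp: S)
    then show ?thesis using A by (simp add: sum.If_cases of_bool_def Int_def)
  qed
  moreover have "g p j k + g p k j + g p j j + g p k k = 1" "g q j k + g q k j + g q j j + g q k k = 0"
    using less jk(3) by (auto simp: g_def p)
  ultimately show ?thesis 
    unfolding p_def[symmetric] expand by linarith
qed

lemma sum_disp_transpose:
  assumes "finite S" "j \<in> S" "k \<in> S" "j \<noteq> k"
  shows "(\<Sum>i\<in>S. \<bar>int ((q \<circ> transpose j k) i) - int i\<bar>) + \<bar>int (q j) - int j\<bar> + \<bar>int (q k) - int k\<bar> =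
    (\<Sum>i\<in>S. \<bar>int (q i) - int i\<bar>) + \<bar>int (q k) - int j\<bar> + \<bar>int (q j) - int k\<bar>"
proof -
  define A where "A = S - {j, k}"
  have S: "S = insert j (insert k A)" and A: "finite A" "j \<notin> A" "k \<notin> A" "j \<noteq> k"
    using assms by (auto simp: A_def)
  have "(\<Sum>i\<in>A. \<bar>int ((q \<circ> transpose j k) i) - int i\<bar>) = (\<Sum>i\<in>A. \<bar>int (q i) - int i\<bar>)"
    using A by (intro sum.cong refl) (auto simp: transpose_def)
  then show ?thesis using A by (simp add: S)
qed

section \<open>Cycles under a transposition\<close>

lemma orbit_eq_if_agree:
  assumes "\<And>y. y \<in> insert x (orbit q x) \<Longrightarrow> p y = q y"
  shows "orbit p x = orbit q x"
proof (intro equalityI subsetI)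
  fix y assume "y \<in> orbit p x"
  then show "y \<in> orbit q x"
    by induction (auto simp: assms orbit.intros)
next
  fix y assume "y \<in> orbit q x"
  then show "y \<in> orbit p x"
  proof induction
    case base
    then show ?case using assms[of x] orbit.base[of p x] by simp
  next
    case (step y)
    then show ?case using assms[of y] orbit.step[of y p x] by simp
  qed
qed

lemma orbit_eq_if_in_orbit:
  assumes "permutation f" "b \<in> orbit f a"
  shows "orbit f b = orbit f a"
  by (rule orbit_cyclic_eq3[OF cyclic_on_orbit'[OF assms(1)] assms(2)])

text \<open>Composing with the transposition inserts the fixed point \<open>x\<close> into the cycle
  of \<open>j\<close>, between \<open>j\<close> and \<open>q j\<close>. Two cycles merge and all
  others stay.\<close>

lemma card_orbits_transpose:
  assumes q: "q permutes S" and fin: "finite S" and jx: "j \<in> S" "x \<in> S" "j \<noteq> x" and fix_x: "q x = x"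
  shows "card (orbit (q \<circ> transpose j x) ` S) + 1 = card (orbit q ` S)"
proof -
  define p where "p = q \<circ> transpose j x"
  define Oj where "Oj = orbit q j"
  have pv: "p x = q j" "p j = x" "\<And>i. i \<noteq> j \<Longrightarrow> i \<noteq> x \<Longrightarrow> p i = q i"
    using fix_x by (auto simp: p_def transpose_def)
  have pq: "permutation q" unfolding permutation_permutes using q fin by auto
  have pp: "p permutes S" unfolding p_def using q jx by (simp add: permutes_compose permutes_swap_id)
  then have ppn: "permutation p" unfolding permutation_permutes using fin by auto
  have ox: "orbit q x = {x}" using fix_x by (simp add: orbit_eq_singleton_iff)
  have jO: "j \<in> Oj" unfolding Oj_def by (rule permutation_self_in_orbit[OF pq])
  have xO: "x \<notin> Oj"
  proof
    assume "x \<in> Oj"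
    then have "orbit q x = Oj" unfolding Oj_def by (rule orbit_eq_if_in_orbit[OF pq])
    then show False using ox jO jx by auto
  qed
  have opx: "orbit p x = insert x Oj"
  proof (intro equalityI subsetI)
    fix y assume "y \<in> orbit p x"
    then show "y \<in> insert x Oj"
    proof induction
      case base then show ?case by (simp add: pv Oj_def orbit.intros)
    next
      case (step y)
      then consider "y = x" | "y = j" | "y \<in> Oj" "y \<noteq> x" "y \<noteq> j" by auto
      then show ?case
        by cases (auto simp: pv Oj_def orbit.intros)
    qed
  next
    fix y assume y: "y \<in> insert x Oj"
    have xx: "x \<in> orbit p x" by (rule permutation_self_in_orbit[OF ppn])
    \<comment> \<open>Following \<open>q\<close> from \<open>j\<close> is following \<open>p\<close>
      from \<open>x\<close>, because \<open>p x = q j\<close>; on return to \<open>j\<close> the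
      path restarts at \<open>x\<close>.\<close>
    have "y \<in> orbit p x" if "y \<in> Oj" using that unfolding Oj_def
    proof induction
      case base
      then show ?case using orbit.base[of p x] by (simp add: pv)
    next
      case (step y)
      have "y \<noteq> x" using step(1) xO by (auto simp: Oj_def)
      then show ?case using orbit.step[OF step(2)] orbit.base[of p x] pv by (cases "y = j") auto
    qed
    then show "y \<in> orbit p x" using y xx by auto
  qed
  have out: "orbit p i = orbit q i" if "i \<notin> insert x Oj" for i
  proof (rule orbit_eq_if_agree)
    fix y assume "y \<in> insert i (orbit q i)"
    then have "y \<in> orbit q i" using permutation_self_in_orbit[OF pq] by auto
    then have oy: "orbit q y = orbit q i" by (rule orbit_eq_if_in_orbit[OF pq])
    have ii: "i \<in> orbit q i" by (rule permutation_self_in_orbit[OF pq])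
    have "y \<noteq> x" using oy ox ii that by auto
    moreover have "y \<noteq> j" using oy ii that by (auto simp: Oj_def)
    ultimately show "p y = q y" by (simp add: pv)
  qed
  \<comment> \<open>\<open>R\<close> collects the cycles common to both permutations; beyond it
    \<open>p\<close> has the one cycle \<open>insert x Oj\<close>, while \<open>q\<close> has
    \<open>{x}\<close> and \<open>Oj\<close>.\<close>
  define R where "R = orbit q ` (S - insert x Oj)"
  have OS: "Oj \<subseteq> S" unfolding Oj_def using q jx by (simp add: permutes_orbit_subset)
  have "orbit p ` S = orbit p ` insert x Oj \<union> orbit p ` (S - insert x Oj)"
    using OS jx by blast
  also have "orbit p ` insert x Oj = {insert x Oj}"
    using orbit_eq_if_in_orbit[OF ppn, of _ x] opx by auto
  also have "orbit p ` (S - insert x Oj) = R" unfolding R_def using out by auto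
  finally have 1: "orbit p ` S = insert (insert x Oj) R" by auto
  have "orbit q ` S = orbit q ` insert x Oj \<union> orbit q ` (S - insert x Oj)"
    using OS jx by blast
  also have "orbit q ` insert x Oj = {{x}, Oj}"
    using orbit_eq_if_in_orbit[OF pq, of _ j] ox jO unfolding Oj_def[symmetric] by auto
  finally have 2: "orbit q ` S = insert {x} (insert Oj R)" unfolding R_def by auto
  have self: "i \<in> orbit q i" for i by (rule permutation_self_in_orbit[OF pq])
  \<comment> \<open>Every member of \<open>R\<close> contains its own base point, which lies outside
    \<open>insert x Oj\<close>.\<close>
  have notin: "T \<notin> R" if "T \<subseteq> insert x Oj" for T
    using that self unfolding R_def by blast
  have "finite R" unfolding R_def using fin by auto
  moreover have "insert x Oj \<notin> R" "{x} \<notin> R" "Oj \<notin> R" by (auto intro!: notin)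
  moreover have "{x} \<noteq> Oj" using xO by auto
  ultimately show ?thesis unfolding p_def[symmetric] 1 2 by simp
qed

text \<open>The constant 2 is the new inversion \<open>(j, k)\<close> plus the cycle lost by
  merging; the merge happens because one of the two positions is a fixed point of
  \<open>q\<close>.\<close>

lemma excess_transpose:
  assumes q: "q permutes S" and fin: "finite S" and jk: "j \<in> S" "k \<in> S" "j < k" and less: "q j < q k"
    and fixed: "q j = j \<or> q k = k"
  shows "excess S (q \<circ> transpose j k) = excess S q
    + \<bar>int (q k) - int j\<bar> + \<bar>int (q j) - int k\<bar> - \<bar>int (q j) - int j\<bar> - \<bar>int (q k) - int k\<bar>
    - 2 - 2 * int (card {i \<in> S. j < i \<and> i < k \<and> q j < q i \<and> q i < q k})"
proof -
  have "card (orbit (q \<circ> transpose j k) ` S) + 1 = card (orbit q ` S)"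
    using fixed card_orbits_transpose[OF q fin, of j k] card_orbits_transpose[OF q fin, of k j] jk
    by (auto simp: transpose_commute)
  moreover have "inj_on q S" using q by (simp add: permutes_inj_on)
  ultimately show ?thesis
    using card_inv_pairs_transpose[OF fin jk _ less] sum_disp_transpose[OF fin jk(1,2), of q] jk(3)
    unfolding excess_def by (simp add: algebra_simps)
qed

section \<open>Undoing the maximum and the minimum\<close>

lemma permutes_insert_fixed:
  assumes "p permutes insert x S" "p x = x"
  shows "p permutes S"
  using assms by (auto intro: permutes_superset)

lemma transpose_value_comp:
  assumes "inj q"
  shows "transpose (q j) (q k) \<circ> q = q \<circ> transpose j k"
  using assms by (auto simp: fun_eq_iff transpose_def inj_eq)

text \<open>With \<open>M\<close> the smaller entries to the left of \<open>j\<close>, the positions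
  before \<open>j\<close> give \<open>L + M = j - 1\<close> and the values below \<open>q j\<close>
  give \<open>R + M = q j - 1\<close>.\<close>

lemma card_larger_left:
  assumes q: "q permutes {1..n}" and j: "j \<in> {1..n}"
  shows "card (larger_left {1..n} q j) + q j = card (smaller_right {1..n} q j) + j"
proof -
  define M where "M = {i \<in> {1..n}. i < j \<and> q i < q j}"
  have inj: "q i = q k \<longleftrightarrow> i = k" for i k using permutes_inj[OF q] by (simp add: inj_eq)
  have range: "q i \<in> {1..n} \<longleftrightarrow> i \<in> {1..n}" for i by (rule permutes_in_image[OF q])
  have "larger_left {1..n} q j \<union> M = {1..<j}"
    using j by (auto simp: larger_left_def M_def) (metis inj less_irrefl linorder_neqE_nat)
  moreover have "larger_left {1..n} q j \<inter> M = {}" by (auto simp: larger_left_def M_def)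
  ultimately have 1: "card (larger_left {1..n} q j) + card M = j - 1"
    by (metis card_Un_disjoint card_atLeastLessThan finite_Un finite_atLeastLessThan)
  have "q ` (smaller_right {1..n} q j \<union> M) = {1..<q j}"
  proof (intro equalityI subsetI)
    fix y assume "y \<in> q ` (smaller_right {1..n} q j \<union> M)"
    then obtain i where "i \<in> {1..n}" "q i < q j" "y = q i" by (auto simp: smaller_right_def M_def)
    then show "y \<in> {1..<q j}" using range[of i] by simp
  next
    fix y assume y: "y \<in> {1..<q j}"
    obtain i where i: "y = q i" using permutes_surj[OF q] by (metis surjD)
    have "i \<in> {1..n}" "i \<noteq> j" using y i range[of i] range[of j] j by auto
    then show "y \<in> q ` (smaller_right {1..n} q j \<union> M)"
      using y i by (auto simp: smaller_right_def M_def)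
  qed
  then have "card (smaller_right {1..n} q j \<union> M) = q j - 1"
    using card_image[of q "smaller_right {1..n} q j \<union> M"] permutes_inj_on[OF q] by simp
  moreover have "smaller_right {1..n} q j \<inter> M = {}" "finite M" "finite (smaller_right {1..n} q j)"
    by (auto simp: smaller_right_def M_def)
  ultimately have 2: "card (smaller_right {1..n} q j) + card M = q j - 1"
    by (metis card_Un_disjoint)
  have "q j \<ge> 1" using range[of j] j by simp
  then show ?thesis using 1 2 j unfolding atLeastAtMost_iff by arith
qed

text \<open>The set \<open>?C\<close> and the smaller entries to the right fill the positions
  strictly between \<open>j\<close> and \<open>n\<close>, so \<open>?C\<close> has
  \<open>n - 1 - j - R\<close> elements. The change in excess becomes
  \<open>j - q j - |q j - j| + 2 R\<close>. Since \<open>j - q j = L - R\<close>, this is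
  \<open>2 L\<close> if \<open>L \<le> R\<close> and \<open>2 R\<close> otherwise.\<close>

lemma excess_transpose_max:
  assumes q: "q permutes {1..n}" and fix_n: "q n = n" and j: "1 \<le> j" "j < n"
  shows "excess {1..n} (transpose (q j) n \<circ> q) = excess {1..n} q
    + 2 * int (min (card (larger_left {1..n} q j)) (card (smaller_right {1..n} q j)))"
proof -
  have inj: "q i = q k \<longleftrightarrow> i = k" for i k using permutes_inj[OF q] by (simp add: inj_eq)
  have range: "q i \<in> {1..n} \<longleftrightarrow> i \<in> {1..n}" for i by (rule permutes_in_image[OF q])
  have less: "q i < n" if "i < n" "1 \<le> i" for i
    using that range[of i] inj[of i n] fix_n by simp
  let ?C = "{i \<in> {1..n}. j < i \<and> i < n \<and> q j < q i \<and> q i < q n}"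
  have "?C \<union> smaller_right {1..n} q j = {j<..<n}"
  proof (intro equalityI subsetI)
    fix i assume "i \<in> ?C \<union> smaller_right {1..n} q j"
    then show "i \<in> {j<..<n}" using less[of j] j fix_n by (cases "i = n") (auto simp: smaller_right_def)
  next
    fix i assume i: "i \<in> {j<..<n}"
    then show "i \<in> ?C \<union> smaller_right {1..n} q j"
      using less[of i] inj[of i j] fix_n by (auto simp: smaller_right_def)
  qed
  moreover have "card (?C \<union> smaller_right {1..n} q j) = card ?C + card (smaller_right {1..n} q j)"
    by (rule card_Un_disjoint) (auto simp: smaller_right_def)
  ultimately have "card ?C + card (smaller_right {1..n} q j) = n - Suc j" by simp
  then have C: "int (card ?C) = int n - 1 - int j - int (card (smaller_right {1..n} q j))"
    using j by linarith
  have "int (card (larger_left {1..n} q j)) + int (q j) = int (card (smaller_right {1..n} q j)) + int j"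
    using card_larger_left[OF q, of j] j by (metis atLeastAtMost_iff less_imp_le of_nat_add)
  moreover have "excess {1..n} (q \<circ> transpose j n) = excess {1..n} q
    + \<bar>int (q n) - int j\<bar> + \<bar>int (q j) - int n\<bar> - \<bar>int (q j) - int j\<bar> - \<bar>int (q n) - int n\<bar>
    - 2 - 2 * int (card ?C)"
    using less[of j] j fix_n by (intro excess_transpose[OF q]) auto
  moreover have "transpose (q j) n \<circ> q = q \<circ> transpose j n"
    using transpose_value_comp[OF permutes_inj[OF q], of j n] fix_n by simp
  ultimately show ?thesis using less[of j] j C by (simp add: fix_n of_nat_min)
qed

text \<open>Mirror image of the maximum: here \<open>?C\<close> and the larger entries to the left
  fill the positions strictly between 1 and \<open>j\<close>, and the change is
  \<open>q j - j - |q j - j| + 2 L\<close>.\<close>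

lemma excess_transpose_min:
  assumes q: "q permutes {1..n}" and fix_1: "q 1 = 1" and j: "1 < j" "j \<le> n"
  shows "excess {1..n} (transpose 1 (q j) \<circ> q) = excess {1..n} q
    + 2 * int (min (card (larger_left {1..n} q j)) (card (smaller_right {1..n} q j)))"
proof -
  have inj: "q i = q k \<longleftrightarrow> i = k" for i k using permutes_inj[OF q] by (simp add: inj_eq)
  have range: "q i \<in> {1..n} \<longleftrightarrow> i \<in> {1..n}" for i by (rule permutes_in_image[OF q])
  have greater: "1 < q i" if "1 < i" "i \<le> n" for i
  proof -
    have "q i \<noteq> 1" using inj[of i 1] fix_1 that by simp
    then show ?thesis using range[of i] that by auto
  qed
  let ?C = "{i \<in> {1..n}. 1 < i \<and> i < j \<and> q 1 < q i \<and> q i < q j}"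
  have "?C \<union> larger_left {1..n} q j = {1<..<j}"
  proof (intro equalityI subsetI)
    fix i assume "i \<in> ?C \<union> larger_left {1..n} q j"
    then show "i \<in> {1<..<j}" using greater[of j] j fix_1 by (cases "i = 1") (auto simp: larger_left_def)
  next
    fix i assume i: "i \<in> {1<..<j}"
    then show "i \<in> ?C \<union> larger_left {1..n} q j"
      using greater[of i] inj[of i j] fix_1 j by (auto simp: larger_left_def)
  qed
  moreover have "card (?C \<union> larger_left {1..n} q j) = card ?C + card (larger_left {1..n} q j)"
    by (rule card_Un_disjoint) (auto simp: larger_left_def)
  ultimately have "card ?C + card (larger_left {1..n} q j) = j - Suc 1" by simp
  then have C: "int (card ?C) = int j - 2 - int (card (larger_left {1..n} q j))"
    using j by linarith
  have "int (card (larger_left {1..n} q j)) + int (q j) = int (card (smaller_right {1..n} q j)) + int j"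
    using card_larger_left[OF q, of j] j by (metis atLeastAtMost_iff less_imp_le of_nat_add)
  moreover have "excess {1..n} (q \<circ> transpose 1 j) = excess {1..n} q
    + \<bar>int (q j) - int 1\<bar> + \<bar>int (q 1) - int j\<bar> - \<bar>int (q 1) - int 1\<bar> - \<bar>int (q j) - int j\<bar>
    - 2 - 2 * int (card ?C)"
    using greater[of j] j fix_1 by (intro excess_transpose[OF q]) auto
  moreover have "transpose 1 (q j) \<circ> q = q \<circ> transpose 1 j"
    using transpose_value_comp[OF permutes_inj[OF q], of 1 j] fix_1 by simp
  ultimately show ?thesis using greater[of j] j C by (simp add: fix_1[simplified] of_nat_min)
qed

text \<open>A fixed extreme point adds nothing to \<open>D\<close> or \<open>I\<close>; it adds one
  point but also one cycle, so \<open>T\<close> is unchanged.\<close>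

lemma excess_insert_fixed:
  assumes p: "p permutes S" and S: "finite S" "x \<notin> S" and extremal: "(\<forall>y\<in>S. x < y) \<or> (\<forall>y\<in>S. y < x)"
  shows "excess (insert x S) p = excess S p"
proof -
  have px: "p x = x" using p S by (simp add: permutes_not_in)
  have img: "p y \<in> S" if "y \<in> S" for y using p that by (simp add: permutes_in_image)
  have "inv_pairs (insert x S) p = inv_pairs S p"
  proof -
    have "\<not> (x < y \<and> p y < p x)" "\<not> (y < x \<and> p x < p y)" if "y \<in> S" for y
      using extremal img[OF that] that unfolding px by (blast dest: less_asym)+
    then show ?thesis by (auto simp: inv_pairs_def)
  qed
  moreover have "{x} \<notin> orbit p ` S"
    using permutes_orbit_subset[OF p] S by (metis image_iff insert_subset)
  moreover have "orbit p x = {x}" by (simp add: orbit_eq_singleton_iff px)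
  ultimately show ?thesis using S px by (simp add: excess_def)
qed

lemma excess_nonneg:
  assumes "p permutes {1..n}"
  shows "0 \<le> excess {1..n} p"
  using assms
proof (induction n arbitrary: p)
  case 0
  then show ?case by (simp add: excess_def inv_pairs_def)
next
  case (Suc n)
  let ?N = "Suc n"
  have nn: "{1..?N} = insert ?N {1..n}" by auto
  have fixed: "0 \<le> excess {1..?N} q" if "q permutes {1..?N}" "q ?N = ?N" for q
  proof -
    have q: "q permutes {1..n}"
      using that permutes_insert_fixed[of q ?N "{1..n}"] by (simp only: nn)
    have "excess (insert ?N {1..n}) q = excess {1..n} q"
      by (rule excess_insert_fixed[OF q]) auto
    then show ?thesis using Suc.IH[OF q] by (simp only: nn)
  qed
  show ?case
  proof (cases "p ?N = ?N")
    case True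
    then show ?thesis using fixed Suc.prems by blast
  next
    case False
    define j where "j = inv p ?N"
    have pj: "p j = ?N" unfolding j_def using Suc.prems by (simp add: permutes_inverses)
    have j: "1 \<le> j" "j < ?N"
      using permutes_in_image[OF Suc.prems, of j] pj False by (auto simp: le_less)
    define q where "q = transpose (p ?N) ?N \<circ> p"
    have "p ?N \<in> {1..?N}" using permutes_in_image[OF Suc.prems, of ?N] by simp
    then have q: "q permutes {1..?N}"
      unfolding q_def using Suc.prems by (intro permutes_compose permutes_swap_id) auto
    have qv: "q ?N = ?N" "q j = p ?N" by (simp_all add: q_def pj)
    have "p = transpose (q j) ?N \<circ> q" by (simp add: qv) (simp add: q_def fun_eq_iff)
    then have "excess {1..?N} p = excess {1..?N} q
        + 2 * int (min (card (larger_left {1..?N} q j)) (card (smaller_right {1..?N} q j)))"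
      using excess_transpose_max[OF q qv(1) j] by (simp only:)
    then show ?thesis using fixed[OF q qv(1)] by linarith
  qed
qed

subsection \<open>Relabelling and symmetries\<close>

definition avoids_132 :: "nat set \<Rightarrow> (nat \<Rightarrow> nat) \<Rightarrow> bool" where
  "avoids_132 S p \<longleftrightarrow> \<not> (\<exists>i\<in>S. \<exists>j\<in>S. \<exists>k\<in>S. i < j \<and> j < k \<and> p i < p k \<and> p k < p j)"

definition avoids_213 :: "nat set \<Rightarrow> (nat \<Rightarrow> nat) \<Rightarrow> bool" where
  "avoids_213 S p \<longleftrightarrow> \<not> (\<exists>i\<in>S. \<exists>j\<in>S. \<exists>k\<in>S. i < j \<and> j < k \<and> p j < p i \<and> p i < p k)"

definition shallow_132 :: "nat set \<Rightarrow> (nat \<Rightarrow> nat) set" where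
  "shallow_132 S = {p. p permutes S \<and> excess S p = 0 \<and> avoids_132 S p}"

text \<open>Conjugation of \<open>p\<close> by \<open>f\<close>, extended by the identity so that
  the result permutes \<open>B\<close>.\<close>

definition relabel :: "(nat \<Rightarrow> nat) \<Rightarrow> nat set \<Rightarrow> nat set \<Rightarrow> (nat \<Rightarrow> nat) \<Rightarrow> nat \<Rightarrow> nat" where
  "relabel f A B p = (\<lambda>x. if x \<in> B then f (p (inv_into A f x)) else x)"

lemma bij_betw_relabel:
  "bij_betw f A B \<Longrightarrow> bij_betw (relabel f A B) {p. p permutes A} {p. p permutes B}"
  unfolding relabel_def by (rule bij_betw_permutations)

lemma relabel_apply:
  assumes "bij_betw f A B" "a \<in> A"
  shows "relabel f A B p (f a) = f (p a)"
  using assms by (auto simp: relabel_def bij_betw_def)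

text \<open>Conjugation carries the orbit of \<open>a\<close> to its image under \<open>f\<close>,
  and taking images is injective on subsets of \<open>A\<close>.\<close>

lemma card_orbits_relabel:
  assumes f: "bij_betw f A B" and p: "p permutes A"
  shows "card (orbit (relabel f A B p) ` B) = card (orbit p ` A)"
proof -
  let ?r = "relabel f A B p"
  have orb: "orbit ?r (f a) = f ` orbit p a" if a: "a \<in> A" for a
  proof -
    have sub: "orbit p a \<subseteq> A" by (rule permutes_orbit_subset[OF p a])
    show ?thesis
    proof (intro equalityI subsetI)
      fix y assume "y \<in> orbit ?r (f a)"
      then show "y \<in> f ` orbit p a"
      proof induction
        case base
        then show ?case using relabel_apply[OF f a] by (auto intro: orbit.base)
      next
        case (step y)
        then obtain z where "z \<in> orbit p a" "y = f z" by auto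
        then show ?case using sub relabel_apply[OF f, of z] by (auto intro: orbit.step)
      qed
    next
      fix y assume "y \<in> f ` orbit p a"
      then obtain z where "z \<in> orbit p a" "y = f z" by auto
      moreover from this(1) have "f z \<in> orbit ?r (f a)"
      proof induction
        case base
        then show ?case using relabel_apply[OF f a, of p] orbit.base[of ?r "f a"] by simp
      next
        case (step z)
        then show ?case using sub relabel_apply[OF f, of z p] orbit.step[OF step(2)] by auto
      qed
      ultimately show "y \<in> orbit ?r (f a)" by simp
    qed
  qed
  have "orbit ?r ` B = (\<lambda>a. f ` orbit p a) ` A"
    using f orb by (auto simp: bij_betw_def image_image)
  also have "\<dots> = (`) f ` orbit p ` A" by (simp add: image_image)
  finally have "orbit ?r ` B = (`) f ` orbit p ` A" .
  moreover have "inj_on ((`) f) (orbit p ` A)"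
    using f permutes_orbit_subset[OF p]
    by (auto simp: bij_betw_def intro!: inj_onI) (metis inj_on_image_eq_iff)+
  ultimately show ?thesis by (simp add: card_image)
qed

text \<open>Covers both the shift (increasing) and reverse-complement (decreasing). A decreasing
  \<open>f\<close> reverses positions and values alike, so an inversion \<open>(a, b)\<close> turns
  into the inversion \<open>(f b, f a)\<close>.\<close>

lemma excess_relabel:
  assumes f: "bij_betw f A B" and p: "p permutes A"
    and dist: "\<And>x y. x \<in> A \<Longrightarrow> y \<in> A \<Longrightarrow> \<bar>int (f x) - int (f y)\<bar> = \<bar>int x - int y\<bar>"
    and mono: "(\<forall>x\<in>A. \<forall>y\<in>A. f x < f y \<longleftrightarrow> x < y) \<or> (\<forall>x\<in>A. \<forall>y\<in>A. f x < f y \<longleftrightarrow> y < x)"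
  shows "excess B (relabel f A B p) = excess A p"
proof -
  let ?r = "relabel f A B p"
  have img: "p a \<in> A" if "a \<in> A" for a using p that by (simp add: permutes_in_image)
  have r: "?r (f a) = f (p a)" if "a \<in> A" for a using relabel_apply[OF f that] .
  have inj: "inj_on f A" and B: "B = f ` A" using f by (auto simp: bij_betw_def)
  have "(\<Sum>i\<in>B. \<bar>int (?r i) - int i\<bar>) = (\<Sum>a\<in>A. \<bar>int (?r (f a)) - int (f a)\<bar>)"
    unfolding B using inj by (simp add: sum.reindex)
  also have "\<dots> = (\<Sum>a\<in>A. \<bar>int (p a) - int a\<bar>)"
    by (intro sum.cong refl) (simp add: r dist img)
  finally have 1: "(\<Sum>i\<in>B. \<bar>int (?r i) - int i\<bar>) = (\<Sum>a\<in>A. \<bar>int (p a) - int a\<bar>)" .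
  have sub: "inv_pairs A p \<subseteq> A \<times> A" by (auto simp: inv_pairs_def)
  have pairs: "inv_pairs B ?r = {(f a, f b) | a b. a \<in> A \<and> b \<in> A \<and> f a < f b \<and> f (p b) < f (p a)}"
  proof -
    have "inv_pairs B ?r = (\<lambda>(a, b). (f a, f b)) ` {(a, b). a \<in> A \<and> b \<in> A \<and> f a < f b \<and> ?r (f b) < ?r (f a)}"
      by (auto simp: inv_pairs_def B)
    also have "{(a, b). a \<in> A \<and> b \<in> A \<and> f a < f b \<and> ?r (f b) < ?r (f a)} =
        {(a, b). a \<in> A \<and> b \<in> A \<and> f a < f b \<and> f (p b) < f (p a)}"
      using r by auto
    finally show ?thesis by auto
  qed
  from mono have 2: "card (inv_pairs B ?r) = card (inv_pairs A p)"
  proof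
    assume m: "\<forall>x\<in>A. \<forall>y\<in>A. f x < f y \<longleftrightarrow> x < y"
    have "inv_pairs B ?r = {(f a, f b) | a b. a \<in> A \<and> b \<in> A \<and> a < b \<and> p b < p a}"
      unfolding pairs using m img by blast
    also have "\<dots> = (\<lambda>(a, b). (f a, f b)) ` inv_pairs A p"
      by (auto simp: inv_pairs_def image_iff)
    finally have "inv_pairs B ?r = (\<lambda>(a, b). (f a, f b)) ` inv_pairs A p" .
    moreover have "inj_on (\<lambda>(a, b). (f a, f b)) (inv_pairs A p)"
      using inj sub by (auto simp: inj_on_def)
    ultimately show ?thesis by (simp add: card_image)
  next
    assume m: "\<forall>x\<in>A. \<forall>y\<in>A. f x < f y \<longleftrightarrow> y < x"
    have "inv_pairs B ?r = {(f b, f a) | a b. a \<in> A \<and> b \<in> A \<and> a < b \<and> p b < p a}"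
      unfolding pairs using m img by blast
    also have "\<dots> = (\<lambda>(a, b). (f b, f a)) ` inv_pairs A p"
      by (auto simp: inv_pairs_def image_iff)
    finally have "inv_pairs B ?r = (\<lambda>(a, b). (f b, f a)) ` inv_pairs A p" .
    moreover have "inj_on (\<lambda>(a, b). (f b, f a)) (inv_pairs A p)"
      using inj sub by (auto simp: inj_on_def)
    ultimately show ?thesis by (simp add: card_image)
  qed
  have "card B = card A" using f by (simp add: bij_betw_same_card)
  then show ?thesis using 1 2 card_orbits_relabel[OF f p] by (simp add: excess_def)
qed

text \<open>Brings counts on intervals starting at 2, which arise when the value 1 is removed, back
  to intervals starting at 1.\<close>

lemma card_shallow_132_shift:
  "card (shallow_132 {Suc a..Suc b}) = card (shallow_132 {a..b})"
proof -
  have f: "bij_betw Suc {a..b} {Suc a..Suc b}" by (simp add: bij_betw_def image_Suc_atLeastAtMost)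
  let ?r = "relabel Suc {a..b} {Suc a..Suc b}"
  have "excess {Suc a..Suc b} (?r p) = 0 \<and> avoids_132 {Suc a..Suc b} (?r p) \<longleftrightarrow>
      excess {a..b} p = 0 \<and> avoids_132 {a..b} p" if p: "p permutes {a..b}" for p
  proof -
    have "excess {Suc a..Suc b} (?r p) = excess {a..b} p"
      by (rule excess_relabel[OF f p]) auto
    moreover have "avoids_132 {Suc a..Suc b} (?r p) \<longleftrightarrow> avoids_132 {a..b} p"
      unfolding avoids_132_def image_Suc_atLeastAtMost[symmetric] bex_simps
      using relabel_apply[OF f] by (auto simp: image_Suc_atLeastAtMost)
    ultimately show ?thesis by simp
  qed
  then have "bij_betw ?r {p \<in> {p. p permutes {a..b}}. excess {a..b} p = 0 \<and> avoids_132 {a..b} p}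
    {p \<in> {p. p permutes {Suc a..Suc b}}. excess {Suc a..Suc b} p = 0 \<and> avoids_132 {Suc a..Suc b} p}"
    by (intro bij_betw_Collect bij_betw_relabel f) auto
  then show ?thesis unfolding shallow_132_def by (simp add: bij_betw_same_card)
qed

text \<open>Reverse-complement is conjugation by \<open>i \<mapsto> n + 1 - i\<close>: 132 read
  backwards is 231, whose complement is 213.\<close>

lemma card_shallow_213:
  "card {p. p permutes {1..n} \<and> excess {1..n} p = 0 \<and> avoids_213 {1..n} p} = card (shallow_132 {1..n})"
proof -
  let ?f = "\<lambda>i. Suc n - i"
  have img: "?f ` {1..n} = {1..n}" 
  proof (intro equalityI subsetI)
    fix x assume "x \<in> {1..n}"
    then show "x \<in> ?f ` {1..n}" by (intro image_eqI[of _ _ "Suc n - x"]) auto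
  qed auto
  then have f: "bij_betw ?f {1..n} {1..n}"
    by (auto simp: bij_betw_def inj_on_def)
  let ?r = "relabel ?f {1..n} {1..n}"
  have "excess {1..n} (?r p) = 0 \<and> avoids_213 {1..n} (?r p) \<longleftrightarrow>
      excess {1..n} p = 0 \<and> avoids_132 {1..n} p" if p: "p permutes {1..n}" for p
  proof -
    have "excess {1..n} (?r p) = excess {1..n} p"
      by (rule excess_relabel[OF f p]) auto
    moreover have "avoids_213 {1..n} (?r p) \<longleftrightarrow> avoids_132 {1..n} p"
    proof -
      have range: "p i \<in> {1..n}" if "i \<in> {1..n}" for i
        using permutes_in_image[OF p] that by blast
      have "avoids_213 (?f ` {1..n}) (?r p) \<longleftrightarrow>
          \<not> (\<exists>i\<in>{1..n}. \<exists>j\<in>{1..n}. \<exists>k\<in>{1..n}. ?f i < ?f j \<and> ?f j < ?f k \<and>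
              ?f (p j) < ?f (p i) \<and> ?f (p i) < ?f (p k))"
        unfolding avoids_213_def bex_simps using relabel_apply[OF f] by simp
      also have "\<dots> \<longleftrightarrow> \<not> (\<exists>i\<in>{1..n}. \<exists>j\<in>{1..n}. \<exists>k\<in>{1..n}. j < i \<and> k < j \<and> p i < p j \<and> p k < p i)"
      proof -
        have "?f x < ?f y \<longleftrightarrow> y < x" if "x \<in> {1..n}" "y \<in> {1..n}" for x y using that by auto
        then show ?thesis using range by (metis (no_types, lifting))
      qed
      also have "\<dots> \<longleftrightarrow> avoids_132 {1..n} p" unfolding avoids_132_def by blast
      finally show ?thesis by (simp only: img)
    qed
    ultimately show ?thesis by simp
  qed
  then have "bij_betw ?r {p \<in> {p. p permutes {1..n}}. excess {1..n} p = 0 \<and> avoids_132 {1..n} p}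
    {p \<in> {p. p permutes {1..n}}. excess {1..n} p = 0 \<and> avoids_213 {1..n} p}"
    by (intro bij_betw_Collect bij_betw_relabel f) auto
  then show ?thesis unfolding shallow_132_def by (simp add: bij_betw_same_card)
qed

declare One_nat_def [simp del]

subsection \<open>Structure of shallow 132-avoiders\<close>

text \<open>A new last entry could only be the 2 of a 132, which has a smaller and a larger entry
  before it; an extreme value does not.\<close>

lemma avoids_132_insert_last:
  assumes "\<And>y. y \<in> S \<Longrightarrow> y < x" and "(\<forall>y\<in>S. p y < p x) \<or> (\<forall>y\<in>S. p x < p y)"
  shows "avoids_132 (insert x S) p \<longleftrightarrow> avoids_132 S p"
proof
  assume av: "avoids_132 S p"
  show "avoids_132 (insert x S) p"
    unfolding avoids_132_def
  proof (intro notI, elim bexE conjE)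
    fix i j k assume ijk: "i \<in> insert x S" "j \<in> insert x S" "k \<in> insert x S"
      and less: "i < j" "j < k" "p i < p k" "p k < p j"
    have ij: "i \<in> S" "j \<in> S"
      using ijk less assms(1)[of i] assms(1)[of j] assms(1)[of k] by auto
    then have "k \<noteq> x" using assms(2) less by (meson less_asym)
    then show False using ij ijk(3) less av unfolding avoids_132_def by blast
  qed
qed (auto simp: avoids_132_def)

text \<open>A new first entry could only be the 1 of a 132, which has two different larger values
  after it.\<close>

lemma avoids_132_insert_first:
  assumes "\<And>y. y \<in> S \<Longrightarrow> x < y" and "\<And>y z. y \<in> S \<Longrightarrow> z \<in> S \<Longrightarrow> \<not> (p x < p y \<and> p y < p z)"
  shows "avoids_132 (insert x S) p \<longleftrightarrow> avoids_132 S p"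
proof
  assume av: "avoids_132 S p"
  show "avoids_132 (insert x S) p"
    unfolding avoids_132_def
  proof (intro notI, elim bexE conjE)
    fix i j k assume ijk: "i \<in> insert x S" "j \<in> insert x S" "k \<in> insert x S"
      and less: "i < j" "j < k" "p i < p k" "p k < p j"
    have "j \<in> S" "k \<in> S" using ijk less assms(1)[of i] assms(1)[of j] assms(1)[of k] by auto
    then show False using ijk(1) less av assms(2) unfolding avoids_132_def by blast
  qed
qed (auto simp: avoids_132_def)

lemma avoids_132_cong:
  assumes "\<And>x y. x \<in> S \<Longrightarrow> y \<in> S \<Longrightarrow> p x < p y \<longleftrightarrow> q x < q y"
  shows "avoids_132 S p \<longleftrightarrow> avoids_132 S q"
  using assms unfolding avoids_132_def by blast

text \<open>Otherwise the maximum would be the 3 between a smaller entry on its left and a larger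
  one on its right.\<close>

lemma avoids_132_before_max_after:
  assumes p: "p permutes {1..n}" and av: "avoids_132 {1..n} p" and pj: "p j = n"
    and ik: "1 \<le> i" "i < j" "j < k" "k \<le> n"
  shows "p k < p i"
proof (rule ccontr)
  assume "\<not> p k < p i"
  moreover have "p k \<noteq> p i" "p k \<noteq> p j" using permutes_inj[OF p] ik by (auto simp: inj_eq)
  moreover have "p k \<le> n" using permutes_in_image[OF p, of k] ik by simp
  ultimately have "p i < p k" "p k < p j" using pj by auto
  then show False using av ik unfolding avoids_132_def by (meson atLeastAtMost_iff less_imp_le less_le_trans le_trans)
qed

text \<open>Permutations of the short interval already fix \<open>Suc b\<close> as functions, so
  this is an equality of sets and not merely a bijection.\<close>

lemma shallow_132_fixed_last:
  assumes "a \<le> Suc b"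
  shows "{p \<in> shallow_132 {a..Suc b}. p (Suc b) = Suc b} = shallow_132 {a..b}"
proof -
  have S: "{a..Suc b} = insert (Suc b) {a..b}" using assms by auto
  have perm: "p permutes {a..Suc b} \<and> p (Suc b) = Suc b \<longleftrightarrow> p permutes {a..b}" for p
  proof
    assume "p permutes {a..Suc b} \<and> p (Suc b) = Suc b"
    then show "p permutes {a..b}"
      unfolding S by (elim conjE) (rule permutes_insert_fixed)
  next
    assume p: "p permutes {a..b}"
    have "p (Suc b) = Suc b" using permutes_not_in[OF p] by simp
    moreover have "p permutes {a..Suc b}" using p by (rule permutes_subset) auto
    ultimately show "p permutes {a..Suc b} \<and> p (Suc b) = Suc b" by blast
  qed
  have agree: "excess {a..Suc b} p = excess {a..b} p \<and> (avoids_132 {a..Suc b} p \<longleftrightarrow> avoids_132 {a..b} p)"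
    if p: "p permutes {a..b}" for p
  proof
    show "excess {a..Suc b} p = excess {a..b} p"
      unfolding S by (rule excess_insert_fixed[OF p]) auto
    have "p (Suc b) = Suc b" using permutes_not_in[OF p] by simp
    moreover have "p y \<le> b" if "y \<in> {a..b}" for y using permutes_in_image[OF p, of y] that by simp
    ultimately show "avoids_132 {a..Suc b} p \<longleftrightarrow> avoids_132 {a..b} p"
      unfolding S by (intro avoids_132_insert_last disjI1) (auto simp: less_Suc_eq_le)
  qed
  show ?thesis
    unfolding shallow_132_def using perm agree by (intro set_eqI) (simp only: mem_Collect_eq, metis)
qed

text \<open>If all three cases fail, the entry relocated by undoing the maximum has both a larger
  entry to its left and a smaller one to its right, so the excess is positive.\<close>

lemma shallow_132_cases:
  assumes "p \<in> shallow_132 {1..n}" and "1 \<le> n"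
  shows "p n = n \<or> p 1 = n \<or> p n = 1"
proof (rule ccontr)
  assume neg: "\<not> ?thesis"
  have p: "p permutes {1..n}" and ex: "excess {1..n} p = 0" and av: "avoids_132 {1..n} p"
    using assms by (auto simp: shallow_132_def)
  define j where "j = inv p n"
  have pj: "p j = n" unfolding j_def using p by (simp add: permutes_inverses)
  have "j \<in> {1..n}" using permutes_in_image[OF p, of j] pj assms(2) by simp
  then have j: "1 < j" "j < n" using neg pj by (auto simp: le_less)
  have pn: "p n \<in> {1..n}" using permutes_in_image[OF p, of n] assms(2) by simp
  define q where "q = transpose (p n) n \<circ> p"
  have q: "q permutes {1..n}"
    unfolding q_def using p pn by (intro permutes_compose permutes_swap_id) auto
  have qv: "q n = n" "q j = p n" by (simp_all add: q_def pj)
  have qi: "q i = p i" if "i \<noteq> j" "i \<noteq> n" for i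
  proof -
    have "p i \<noteq> p n" "p i \<noteq> n" using permutes_inj[OF p] pj that by (auto simp: inj_eq)
    then show ?thesis by (simp add: q_def)
  qed
  have "p = transpose (q j) n \<circ> q" unfolding qv(2) by (simp add: q_def fun_eq_iff)
  then have "excess {1..n} p = excess {1..n} q
      + 2 * int (min (card (larger_left {1..n} q j)) (card (smaller_right {1..n} q j)))"
    using excess_transpose_max[OF q qv(1), of j] j by (simp only:)
  then have "min (card (larger_left {1..n} q j)) (card (smaller_right {1..n} q j)) = 0"
    using ex excess_nonneg[OF q] by linarith
  moreover have "finite (larger_left {1..n} q j)" "finite (smaller_right {1..n} q j)"
    by (auto simp: larger_left_def smaller_right_def)
  ultimately have "larger_left {1..n} q j = {} \<or> smaller_right {1..n} q j = {}"
    by (auto simp: min_def split: if_splits)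
  \<comment> \<open>The first entry precedes the maximum and hence exceeds \<open>p n\<close>, the
    relocated entry.\<close>
  moreover have "1 \<in> larger_left {1..n} q j"
    using avoids_132_before_max_after[OF p av pj, of 1 n] j qi[of 1] by (simp add: larger_left_def qv)
  \<comment> \<open>The value 1 cannot precede the maximum, since entries there exceed
    \<open>p n\<close>.\<close>
  moreover have "inv p 1 \<in> smaller_right {1..n} q j"
  proof -
    define i where "i = inv p 1"
    have i1: "p i = 1" unfolding i_def using p by (simp add: permutes_inverses)
    have "i \<in> {1..n}" using permutes_in_image[OF p, of i] i1 assms(2) by simp
    moreover have "i \<noteq> j" "i \<noteq> n" using i1 pj neg j by auto
    moreover have "\<not> i < j"
      using avoids_132_before_max_after[OF p av pj, of i n] j i1 pn calculation by auto
    moreover have "p n > 1" using pn neg by auto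
    ultimately show ?thesis
      unfolding i_def[symmetric] using qi[of i] i1 by (auto simp: smaller_right_def qv)
  qed
  ultimately show False by auto
qed

text \<open>Reindexing by \<open>p\<close> preserves the displacement,
  \<open>(i, j) \<mapsto> (p j, p i)\<close> matches the inversions, and the cycles are the same
  sets.\<close>

lemma excess_inv:
  assumes p: "p permutes S" and S: "finite S"
  shows "excess S (inv p) = excess S p"
proof -
  have img: "p a \<in> S \<longleftrightarrow> a \<in> S" "inv p a \<in> S \<longleftrightarrow> a \<in> S" for a
    using permutes_in_image[OF p] permutes_in_image[OF permutes_inv[OF p]] by auto
  note pi = permutes_inverses[OF p]
  have "(\<Sum>i\<in>S. \<bar>int (inv p i) - int i\<bar>) = (\<Sum>i\<in>S. \<bar>int (inv p (p i)) - int (p i)\<bar>)"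
    using sum.permute[OF p, of "\<lambda>i. \<bar>int (inv p i) - int i\<bar>"] by (simp add: o_def)
  also have "\<dots> = (\<Sum>i\<in>S. \<bar>int (p i) - int i\<bar>)" by (simp add: pi abs_minus_commute)
  finally have 1: "(\<Sum>i\<in>S. \<bar>int (inv p i) - int i\<bar>) = (\<Sum>i\<in>S. \<bar>int (p i) - int i\<bar>)" .
  have "bij_betw (\<lambda>(i, j). (p j, p i)) (inv_pairs S p) (inv_pairs S (inv p))"
    by (rule bij_betw_byWitness[where f' = "\<lambda>(i, j). (inv p j, inv p i)"])
      (auto simp: inv_pairs_def pi img)
  then have 2: "card (inv_pairs S (inv p)) = card (inv_pairs S p)"
    by (simp add: bij_betw_same_card)
  have "permutation p" unfolding permutation_permutes using p S by auto
  then have "orbit (inv p) ` S = orbit p ` S" by (simp add: orbit_inv_eq)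
  then show ?thesis using 1 2 by (simp add: excess_def)
qed

text \<open>The pattern 132 is its own inverse: an occurrence at \<open>i < j < k\<close> in
  \<open>inv p\<close> gives one in \<open>p\<close> with values \<open>i\<close>, \<open>k\<close>,
  \<open>j\<close> in this order.\<close>

lemma avoids_132_inv:
  assumes p: "p permutes S" and "avoids_132 S p"
  shows "avoids_132 S (inv p)"
  unfolding avoids_132_def
proof safe
  fix i j k assume "i \<in> S" "j \<in> S" "k \<in> S" "i < j" "j < k" "inv p i < inv p k" "inv p k < inv p j"
  then have "inv p i \<in> S" "inv p k \<in> S" "inv p j \<in> S" "p (inv p i) < p (inv p j)" "p (inv p j) < p (inv p k)"
    using permutes_in_image[OF permutes_inv[OF p]] by (auto simp: permutes_inverses[OF p])
  with \<open>inv p i < inv p k\<close> \<open>inv p k < inv p j\<close> show False using assms(2) unfolding avoids_132_def by blast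
qed

lemma shallow_132_inv:
  assumes "p \<in> shallow_132 S" "finite S"
  shows "inv p \<in> shallow_132 S"
  using assms by (auto simp: shallow_132_def permutes_inv excess_inv avoids_132_inv)

lemma card_shallow_132_first_max:
  "card {p \<in> shallow_132 {1..n}. p 1 = n} = card {p \<in> shallow_132 {1..n}. p n = 1}"
proof (rule bij_betw_same_card[of inv], rule bij_betw_byWitness[where f' = inv])
  have perm: "p permutes {1..n}" if "p \<in> shallow_132 {1..n}" for p using that by (simp add: shallow_132_def)
  show "\<forall>p\<in>{p \<in> shallow_132 {1..n}. p 1 = n}. inv (inv p) = p"
    "\<forall>p\<in>{p \<in> shallow_132 {1..n}. p n = 1}. inv (inv p) = p"
    using permutes_inv_inv[OF perm] by auto
  show "inv ` {p \<in> shallow_132 {1..n}. p 1 = n} \<subseteq> {p \<in> shallow_132 {1..n}. p n = 1}"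
    "inv ` {p \<in> shallow_132 {1..n}. p n = 1} \<subseteq> {p \<in> shallow_132 {1..n}. p 1 = n}"
    using permutes_inv_eq[OF perm] by (auto intro: shallow_132_inv)
qed

section \<open>Permutations ending in 1, by the position of the maximum\<close>

lemma card_eq_comp:
  assumes "t' \<circ> t = id" "t \<circ> t' = id"
    and "\<And>q. q \<in> D \<Longrightarrow> t \<circ> q \<in> C" "\<And>p. p \<in> C \<Longrightarrow> t' \<circ> p \<in> D"
  shows "card C = card D"
proof (rule sym, rule bij_betw_same_card, rule bij_betw_byWitness[where f = "\<lambda>q. t \<circ> q" and f' = "\<lambda>p. t' \<circ> p"])
  show "\<forall>q\<in>D. t' \<circ> (t \<circ> q) = q" "\<forall>p\<in>C. t \<circ> (t' \<circ> p) = p"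
    using assms(1,2) by (simp_all add: o_assoc)
qed (use assms in auto)

lemma excess_extend:
  assumes q: "q permutes {2..m}" and m: "1 \<le> m"
  shows "excess {1..Suc m} q = excess {2..m} q"
proof -
  have "{1..Suc m} = insert (Suc m) (insert 1 {2..m})" using m by auto
  moreover have "excess (insert 1 {2..m}) q = excess {2..m} q"
    by (rule excess_insert_fixed[OF q]) auto
  moreover have "excess (insert (Suc m) (insert 1 {2..m})) q = excess (insert 1 {2..m}) q"
    using m by (intro excess_insert_fixed permutes_subset[OF q]) auto
  ultimately show ?thesis by simp
qed

text \<open>The relocated entry is 1, so nothing smaller stands to its right and
  \<open>min(L, R)\<close> vanishes.\<close>

lemma excess_swap_max_with_1:
  assumes q: "q permutes {1..Suc m}" and qv: "q (Suc m) = Suc m" "q j = 1" and j: "1 \<le> j" "j \<le> m"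
  shows "excess {1..Suc m} (transpose 1 (Suc m) \<circ> q) = excess {1..Suc m} q"
proof -
  have "1 \<le> q i" if "i \<in> {1..Suc m}" for i using permutes_in_image[OF q, of i] that by simp
  then have "smaller_right {1..Suc m} q j = {}"
    by (fastforce simp: smaller_right_def qv(2))
  then show ?thesis using excess_transpose_max[OF q qv(1), of j] j unfolding qv(2) by simp
qed

lemma excess_swap_max_with_1_insert:
  assumes q: "q permutes {1..m}" and m: "1 \<le> m"
  shows "excess {1..Suc m} (transpose 1 (Suc m) \<circ> q) = excess {1..m} q"
proof -
  have S: "{1..Suc m} = insert (Suc m) {1..m}" by auto
  have q': "q permutes {1..Suc m}" using q by (rule permutes_subset) auto
  define j where "j = inv q 1"
  have qj: "q j = 1" unfolding j_def using q by (simp add: permutes_inverses)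
  then have "j \<in> {1..m}" using permutes_in_image[OF q, of j] m by simp
  moreover have "q (Suc m) = Suc m" using q by (simp add: permutes_not_in)
  moreover have "excess {1..Suc m} q = excess {1..m} q"
    unfolding S by (rule excess_insert_fixed[OF q]) auto
  ultimately show ?thesis using excess_swap_max_with_1[OF q' _ qj] by auto
qed

text \<open>Swapping the values 1 and \<open>Suc m\<close> makes both fixed points and leaves a
  permutation of \<open>{2..m}\<close>. A maximum in front and a minimum at the end take part in no
  132.\<close>

lemma card_shallow_132_first_max_last_min:
  assumes m: "1 \<le> m"
  shows "card {p \<in> shallow_132 {1..Suc m}. p (Suc m) = 1 \<and> p 1 = Suc m} = card (shallow_132 {2..m})"
proof -
  define t where "t = transpose 1 (Suc m)"
  have S: "{1..Suc m} = insert (Suc m) (insert 1 {2..m})" using m by auto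
  have t: "t \<circ> t = id" by (simp add: t_def)
  have tv: "t 1 = Suc m" "t (Suc m) = 1" "\<And>i. i \<in> {2..m} \<Longrightarrow> t i = i"
    by (auto simp: t_def transpose_def)
  have key: "excess {1..Suc m} (t \<circ> q) = excess {2..m} q"
      "avoids_132 {1..Suc m} (t \<circ> q) \<longleftrightarrow> avoids_132 {2..m} q"
      "(t \<circ> q) (Suc m) = 1" "(t \<circ> q) 1 = Suc m"
      "t \<circ> q permutes {1..Suc m}"
    if q: "q permutes {2..m}" for q
  proof -
    have q1: "q permutes {1..Suc m}" using q by (rule permutes_subset) auto
    have qv: "q 1 = 1" "q (Suc m) = Suc m" using q by (auto simp: permutes_not_in)
    show pv: "(t \<circ> q) (Suc m) = 1" "(t \<circ> q) 1 = Suc m" by (simp_all add: qv tv)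
    have pi: "(t \<circ> q) i = q i" "q i \<in> {2..m}" if "i \<in> {2..m}" for i
      using that permutes_in_image[OF q, of i] tv by auto
    show "t \<circ> q permutes {1..Suc m}"
      unfolding t_def using q1 by (intro permutes_compose permutes_swap_id) auto
    show "excess {1..Suc m} (t \<circ> q) = excess {2..m} q"
      using excess_swap_max_with_1[OF q1 qv(2,1)] m excess_extend[OF q m] by (simp add: t_def)
    have gt: "\<forall>y\<in>insert 1 {2..m}. (t \<circ> q) (Suc m) < (t \<circ> q) y"
      using m pv pi by (simp del: comp_apply) fastforce
    have lt: "(t \<circ> q) y < (t \<circ> q) 1" if "y \<in> {2..m}" for y
      using pv pi[OF that] by simp
    have "avoids_132 {1..Suc m} (t \<circ> q) \<longleftrightarrow> avoids_132 (insert 1 {2..m}) (t \<circ> q)"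
      unfolding S using m by (intro avoids_132_insert_last disjI2 gt) auto
    also have "\<dots> \<longleftrightarrow> avoids_132 {2..m} (t \<circ> q)"
    proof (rule avoids_132_insert_first)
      show "\<not> ((t \<circ> q) 1 < (t \<circ> q) y \<and> (t \<circ> q) y < (t \<circ> q) z)" if "y \<in> {2..m}" for y z
        using lt[OF that] by (simp del: comp_apply)
    qed auto
    also have "\<dots> \<longleftrightarrow> avoids_132 {2..m} q"
      using pi(1) by (intro avoids_132_cong) simp
    finally show "avoids_132 {1..Suc m} (t \<circ> q) \<longleftrightarrow> avoids_132 {2..m} q" .
  qed
  show ?thesis
  proof (rule card_eq_comp[OF t t])
    fix q assume "q \<in> shallow_132 {2..m}"
    then show "t \<circ> q \<in> {p \<in> shallow_132 {1..Suc m}. p (Suc m) = 1 \<and> p 1 = Suc m}"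
      using key[of q] by (simp add: shallow_132_def del: comp_apply)
  next
    fix p assume p: "p \<in> {p \<in> shallow_132 {1..Suc m}. p (Suc m) = 1 \<and> p 1 = Suc m}"
    then have "t \<circ> p permutes {1..Suc m}"
      unfolding t_def by (intro permutes_compose permutes_swap_id) (auto simp: shallow_132_def)
    moreover have "(t \<circ> p) 1 = 1" "(t \<circ> p) (Suc m) = Suc m" using p tv by auto
    ultimately have q: "t \<circ> p permutes {2..m}"
      unfolding S by (metis permutes_insert_fixed)
    have "p = t \<circ> (t \<circ> p)" using t by (simp add: o_assoc)
    then show "t \<circ> p \<in> shallow_132 {2..m}"
      using key(1,2)[OF q] p q by (simp add: shallow_132_def del: comp_apply)
  qed
qed

text \<open>Undoing the maximum moves the final 1 to position \<open>m\<close>, free of cost in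
  excess.\<close>

lemma card_shallow_132_penultimate_max_last_min:
  assumes m: "1 \<le> m"
  shows "card {p \<in> shallow_132 {1..Suc m}. p (Suc m) = 1 \<and> p m = Suc m}
    = card {q \<in> shallow_132 {1..m}. q m = 1}"
proof -
  define t where "t = transpose 1 (Suc m)"
  have S: "{1..Suc m} = insert (Suc m) {1..m}" "{1..Suc m} = insert (Suc m) (insert m {1..<m})"
    "{1..m} = insert m {1..<m}" using m by auto
  have t: "t \<circ> t = id" by (simp add: t_def)
  have tv: "t 1 = Suc m" "t (Suc m) = 1" "\<And>i. i \<in> {2..m} \<Longrightarrow> t i = i"
    by (auto simp: t_def transpose_def)
  have key: "excess {1..Suc m} (t \<circ> q) = excess {1..m} q"
      "avoids_132 {1..Suc m} (t \<circ> q) \<longleftrightarrow> avoids_132 {1..m} q"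
      "(t \<circ> q) (Suc m) = 1" "(t \<circ> q) m = Suc m"
      "t \<circ> q permutes {1..Suc m}"
    if q: "q permutes {1..m}" and qm: "q m = 1" for q
  proof -
    have q1: "q permutes {1..Suc m}" using q by (rule permutes_subset) auto
    have qv: "q (Suc m) = Suc m" using q by (auto simp: permutes_not_in)
    show pv: "(t \<circ> q) (Suc m) = 1" "(t \<circ> q) m = Suc m" by (simp_all add: qv qm tv)
    have pi: "(t \<circ> q) i = q i" "1 < q i" "q i \<le> m" if "i \<in> {1..<m}" for i
    proof -
      have "q i \<noteq> 1" using that permutes_inj[OF q] qm by (metis atLeastLessThan_iff inj_eq less_irrefl)
      moreover have "q i \<in> {1..m}" using permutes_in_image[OF q, of i] that by auto
      ultimately show "(t \<circ> q) i = q i" "1 < q i" "q i \<le> m" using tv(3)[of "q i"] by auto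
    qed
    show "t \<circ> q permutes {1..Suc m}"
      unfolding t_def using q1 by (intro permutes_compose permutes_swap_id) auto
    show "excess {1..Suc m} (t \<circ> q) = excess {1..m} q"
      using excess_swap_max_with_1_insert[OF q m] by (simp add: t_def)
    have gt: "\<forall>y\<in>insert m {1..<m}. (t \<circ> q) (Suc m) < (t \<circ> q) y"
      using m pv pi by (simp del: comp_apply)
    have lt: "\<forall>y\<in>{1..<m}. (t \<circ> q) y < (t \<circ> q) m"
      using pv pi by (simp del: comp_apply add: less_Suc_eq_le)
    \<comment> \<open>Strip the final 1 and the maximum before it, compare the common entries on
      \<open>{1..<m}\<close>, then restore the final 1 of \<open>q\<close>.\<close>
    have "avoids_132 {1..Suc m} (t \<circ> q) \<longleftrightarrow> avoids_132 (insert m {1..<m}) (t \<circ> q)"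
      unfolding S(2) by (intro avoids_132_insert_last disjI2 gt) auto
    also have "\<dots> \<longleftrightarrow> avoids_132 {1..<m} (t \<circ> q)"
      by (intro avoids_132_insert_last disjI1 lt) auto
    also have "\<dots> \<longleftrightarrow> avoids_132 {1..<m} q"
      using pi(1) by (intro avoids_132_cong) simp
    also have "\<dots> \<longleftrightarrow> avoids_132 {1..m} q"
      unfolding S(3) using pi qm by (intro avoids_132_insert_last[symmetric]) auto
    finally show "avoids_132 {1..Suc m} (t \<circ> q) \<longleftrightarrow> avoids_132 {1..m} q" .
  qed
  show ?thesis
  proof (rule card_eq_comp[OF t t])
    fix q assume "q \<in> {q \<in> shallow_132 {1..m}. q m = 1}"
    then show "t \<circ> q \<in> {p \<in> shallow_132 {1..Suc m}. p (Suc m) = 1 \<and> p m = Suc m}"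
      using key[of q] by (simp add: shallow_132_def del: comp_apply)
  next
    fix p assume p: "p \<in> {p \<in> shallow_132 {1..Suc m}. p (Suc m) = 1 \<and> p m = Suc m}"
    then have "t \<circ> p permutes {1..Suc m}"
      unfolding t_def by (intro permutes_compose permutes_swap_id) (auto simp: shallow_132_def)
    moreover have qv: "(t \<circ> p) m = 1" "(t \<circ> p) (Suc m) = Suc m" using p tv by auto
    ultimately have q: "t \<circ> p permutes {1..m}"
      unfolding S(1) by (metis permutes_insert_fixed)
    have "p = t \<circ> (t \<circ> p)" using t by (simp add: o_assoc)
    then show "t \<circ> p \<in> {q \<in> shallow_132 {1..m}. q m = 1}"
      using key(1,2)[OF q qv(1)] p q qv(1) by (simp add: shallow_132_def del: comp_apply)
  qed
qed

text \<open>Undoing the maximum (\<open>t\<close>) and then the minimum (\<open>u\<close>) leaves a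
  permutation of \<open>{2..m}\<close>. Conversely, the maximum \<open>m\<close> of \<open>q\<close>
  is raised to \<open>Suc m\<close> in place, \<open>m\<close> is put in front and 1 at the end;
  \<open>q m \<noteq> m\<close> says that the maximum is not last but one.\<close>

lemma card_shallow_132_inner_max_last_min:
  assumes m: "2 \<le> m"
  shows "card {p \<in> shallow_132 {1..Suc m}. p (Suc m) = 1 \<and> p 1 \<noteq> Suc m \<and> p m \<noteq> Suc m}
    = card {q \<in> shallow_132 {2..m}. q m \<noteq> m}"
proof -
  define t where "t = transpose 1 (Suc m)"
  define u where "u = transpose 1 m"
  have S: "{1..Suc m} = insert (Suc m) (insert 1 {2..m})" using m by auto
  have tu: "t \<circ> t = id" "u \<circ> u = id" by (simp_all add: t_def u_def)
  have tv: "t 1 = Suc m" "t (Suc m) = 1" "\<And>i. i \<in> {2..m} \<Longrightarrow> t i = i"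
    by (auto simp: t_def transpose_def)
  have uv: "u 1 = m" "u m = 1" "u (Suc m) = Suc m" "\<And>i. i \<in> {2..<m} \<Longrightarrow> u i = i"
    using m by (auto simp: u_def transpose_def)
  have "(u \<circ> t) \<circ> (t \<circ> u) = u \<circ> (t \<circ> t) \<circ> u" "(t \<circ> u) \<circ> (u \<circ> t) = t \<circ> (u \<circ> u) \<circ> t"
    by (simp_all only: o_assoc)
  then have inverse: "(u \<circ> t) \<circ> (t \<circ> u) = id" "(t \<circ> u) \<circ> (u \<circ> t) = id"
    using tu by simp_all
  have u_perm: "u permutes {1..Suc m}" and t_perm: "t permutes {1..Suc m}"
    unfolding u_def t_def using m by (auto intro: permutes_swap_id)
  have key: "excess {1..Suc m} (t \<circ> u \<circ> q) = excess {2..m} q"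
      "avoids_132 {1..Suc m} (t \<circ> u \<circ> q) \<longleftrightarrow> avoids_132 {2..m} q"
      "(t \<circ> u \<circ> q) (Suc m) = 1" "(t \<circ> u \<circ> q) 1 \<noteq> Suc m" "(t \<circ> u \<circ> q) m \<noteq> Suc m"
      "t \<circ> u \<circ> q permutes {1..Suc m}"
    if q: "q permutes {2..m}" and qm: "q m \<noteq> m" for q
  proof -
    have q1: "q permutes {1..Suc m}" using q by (rule permutes_subset) auto
    have qv: "q 1 = 1" "q (Suc m) = Suc m" using q by (auto simp: permutes_not_in)
    define p where "p = t \<circ> u \<circ> q"
    define j where "j = inv q m"
    have qj: "q j = m" unfolding j_def using q by (simp add: permutes_inverses)
    have "j \<in> {2..m}" using permutes_in_image[OF q, of j] qj m by simp
    then have j: "2 \<le> j" "j < m" using qm qj by (auto simp: le_less)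
    have range: "q i \<in> {2..m}" if "i \<in> {2..m}" for i using that permutes_in_image[OF q, of i] by simp
    have qi: "q i \<in> {2..<m}" if "i \<in> {2..m}" "i \<noteq> j" for i
    proof -
      have "q i \<noteq> m" using permutes_inj[OF q] qj that(2) by (metis inj_eq)
      then show ?thesis using range[OF that(1)] by auto
    qed
    have pv: "p (Suc m) = 1" "p 1 = m" "p j = Suc m"
      using m by (simp_all add: p_def qv qj uv tv)
    have pi: "p i = q i" if "i \<in> {2..m}" "i \<noteq> j" for i
      using qi[OF that] uv(4)[of "q i"] tv(3)[of "q i"] by (simp add: p_def)
    show "(t \<circ> u \<circ> q) (Suc m) = 1" using pv by (simp add: p_def)
    show "(t \<circ> u \<circ> q) 1 \<noteq> Suc m" using pv(2) by (simp add: p_def)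
    have "p m = q m" using pi[of m] j m by simp
    then show "(t \<circ> u \<circ> q) m \<noteq> Suc m" using range[of m] m by (simp add: p_def)
    show "t \<circ> u \<circ> q permutes {1..Suc m}"
      using q1 u_perm t_perm by (intro permutes_compose)
    have r: "u \<circ> q permutes {1..Suc m}" using q1 u_perm by (rule permutes_compose)
    \<comment> \<open>The entry at \<open>j\<close> is \<open>m\<close>, the largest value before
      position \<open>Suc m\<close>, so undoing the minimum is also free.\<close>
    have "larger_left {1..Suc m} q j = {}"
    proof -
      have "q i \<le> m" if "1 \<le> i" "i < j" for i
        using range[of i] qv that j by (cases "i = 1") auto
      then show ?thesis by (fastforce simp: larger_left_def qj)
    qed
    then have "excess {1..Suc m} (u \<circ> q) = excess {1..Suc m} q"
      using excess_transpose_min[OF q1 qv(1), of j] j by (simp add: qj u_def)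
    moreover have "excess {1..Suc m} (t \<circ> (u \<circ> q)) = excess {1..Suc m} (u \<circ> q)"
      unfolding t_def using j by (intro excess_swap_max_with_1[OF r, of j]) (simp_all add: qv qj uv)
    ultimately show "excess {1..Suc m} (t \<circ> u \<circ> q) = excess {2..m} q"
      using excess_extend[OF q] m by (simp add: o_assoc)
    have pos: "1 < p i" if "i \<in> insert 1 {2..m}" for i
      using pv qi[of i] pi[of i] that m by (cases "i = j") auto
    have "avoids_132 {1..Suc m} p \<longleftrightarrow> avoids_132 (insert 1 {2..m}) p"
      unfolding S using m pos pv(1) by (intro avoids_132_insert_last disjI2) auto
    \<comment> \<open>Only \<open>Suc m\<close> exceeds \<open>p 1 = m\<close>, so the first entry
      cannot begin a 132.\<close>
    also have "\<dots> \<longleftrightarrow> avoids_132 {2..m} p"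
    proof (rule avoids_132_insert_first)
      fix y z assume yz: "y \<in> {2..m}" "z \<in> {2..m}"
      have "p y \<le> m \<or> p y = Suc m" "p z \<le> Suc m"
        using pv qi[OF yz(1)] pi[OF yz(1)] qi[OF yz(2)] pi[OF yz(2)]
        by (cases "y = j"; cases "z = j"; force)+
      then show "\<not> (p 1 < p y \<and> p y < p z)" using pv by auto
    qed auto
    \<comment> \<open>On \<open>{2..m}\<close> the two differ only at \<open>j\<close>, where both
      have their maximum.\<close>
    also have "\<dots> \<longleftrightarrow> avoids_132 {2..m} q"
    proof (rule avoids_132_cong)
      fix x y assume "x \<in> {2..m}" "y \<in> {2..m}"
      then show "p x < p y \<longleftrightarrow> q x < q y"
        using pv qj qi[of x] qi[of y] pi[of x] pi[of y] by (cases "x = j"; cases "y = j"; force)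
    qed
    finally show "avoids_132 {1..Suc m} (t \<circ> u \<circ> q) \<longleftrightarrow> avoids_132 {2..m} q" by (simp only: p_def)
  qed
  show ?thesis
  proof (rule card_eq_comp[OF inverse])
    fix q assume "q \<in> {q \<in> shallow_132 {2..m}. q m \<noteq> m}"
    then show "t \<circ> u \<circ> q \<in> {p \<in> shallow_132 {1..Suc m}. p (Suc m) = 1 \<and> p 1 \<noteq> Suc m \<and> p m \<noteq> Suc m}"
      using key[of q] by (simp add: shallow_132_def del: comp_apply)
  next
    fix p assume p: "p \<in> {p \<in> shallow_132 {1..Suc m}. p (Suc m) = 1 \<and> p 1 \<noteq> Suc m \<and> p m \<noteq> Suc m}"
    then have pp: "p permutes {1..Suc m}" and ex: "excess {1..Suc m} p = 0" and av: "avoids_132 {1..Suc m} p"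
      and pn: "p (Suc m) = 1" "p 1 \<noteq> Suc m" "p m \<noteq> Suc m"
      by (auto simp: shallow_132_def)
    have inj: "p i = p k \<longleftrightarrow> i = k" for i k using permutes_inj[OF pp] by (simp add: inj_eq)
    have range: "p i \<in> {1..Suc m} \<longleftrightarrow> i \<in> {1..Suc m}" for i by (rule permutes_in_image[OF pp])
    define j where "j = inv p (Suc m)"
    have pj: "p j = Suc m" unfolding j_def using pp by (simp add: permutes_inverses)
    have "j \<in> {1..Suc m}" using range[of j] pj by simp
    moreover have "j \<noteq> 1" "j \<noteq> m" "j \<noteq> Suc m" using pn pj m by auto
    ultimately have j: "1 < j" "j < m" by auto
    define r where "r = t \<circ> p"
    have r: "r permutes {1..Suc m}" unfolding r_def using pp t_perm by (rule permutes_compose)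
    have rv: "r (Suc m) = Suc m" "r j = 1" by (simp_all add: r_def pn pj tv)
    have ri: "r i = p i" "p i \<in> {2..m}" if "i \<in> {1..m}" "i \<noteq> j" for i
    proof -
      have "p i \<noteq> 1" "p i \<noteq> Suc m" using inj[of i "Suc m"] inj[of i j] pn pj that by auto
      then show "p i \<in> {2..m}" using range[of i] that by auto
      then show "r i = p i" using tv by (simp add: r_def)
    qed
    have p_eq: "p = transpose 1 (Suc m) \<circ> r" using tu by (simp add: r_def o_assoc t_def)
    have exr: "excess {1..Suc m} r = 0"
      using excess_swap_max_with_1[OF r rv] j ex p_eq by simp
    \<comment> \<open>After undoing the maximum, 1 sits at \<open>j\<close>; undoing the minimum
      moves it to the front and relocates \<open>p 1\<close> to \<open>j\<close>.\<close>
    define s where "s = transpose 1 (r 1) \<circ> r"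
    have r1: "r 1 = p 1" "p 1 \<in> {2..m}" using ri[of 1] j by auto
    have s: "s permutes {1..Suc m}"
      unfolding s_def using r r1 by (intro permutes_compose permutes_swap_id) auto
    have sv: "s 1 = 1" "s j = p 1" by (simp_all add: s_def rv r1)
    have si: "s i = p i" if "i \<in> {2..m}" "i \<noteq> j" for i
    proof -
      have "r i = p i" "p i \<in> {2..m}" using ri[of i] that by auto
      moreover have "p i \<noteq> p 1" using inj that by auto
      ultimately show ?thesis by (simp add: s_def r1)
    qed
    have "r = transpose 1 (s j) \<circ> s" by (simp add: s_def rv fun_eq_iff)
    then have "excess {1..Suc m} r = excess {1..Suc m} s
      + 2 * int (min (card (larger_left {1..Suc m} s j)) (card (smaller_right {1..Suc m} s j)))"
      using excess_transpose_min[OF s sv(1), of j] j by simp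
    then have "min (card (larger_left {1..Suc m} s j)) (card (smaller_right {1..Suc m} s j)) = 0"
      using exr excess_nonneg[OF s] by linarith
    moreover have "finite (larger_left {1..Suc m} s j)" "finite (smaller_right {1..Suc m} s j)"
      by (auto simp: larger_left_def smaller_right_def)
    ultimately have "larger_left {1..Suc m} s j = {} \<or> smaller_right {1..Suc m} s j = {}"
      by (auto simp: min_def split: if_splits)
    \<comment> \<open>Position \<open>m\<close> lies after the maximum and supplies a smaller entry
      to the right, so zero excess leaves no larger entry to the left.\<close>
    moreover have "p m < p 1" using avoids_132_before_max_after[OF pp av pj, of 1 m] j by simp
    then have "m \<in> smaller_right {1..Suc m} s j"
      using si[of m] j m by (simp add: smaller_right_def sv)
    ultimately have no_larger: "larger_left {1..Suc m} s j = {}" by auto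
    \<comment> \<open>Otherwise the value \<open>m\<close> exceeds \<open>p 1\<close>, hence
      precedes the maximum, and is a larger entry to the left of the relocated
      \<open>p 1\<close>.\<close>
    have p1: "p 1 = m"
    proof (rule ccontr)
      assume p1: "p 1 \<noteq> m"
      define k where "k = inv p m"
      have pk: "p k = m" unfolding k_def using pp by (simp add: permutes_inverses)
      have "k \<in> {1..Suc m}" using range[of k] pk m by simp
      moreover have "k \<noteq> 1" "k \<noteq> j" "k \<noteq> Suc m" using pk p1 pj pn m by auto
      ultimately have k: "k \<in> {2..m}" "k \<noteq> j" by auto
      have "\<not> j < k"
        using avoids_132_before_max_after[OF pp av pj, of 1 k] j k pk r1 by auto
      then have "k \<in> larger_left {1..Suc m} s j"
        using si[OF k] k pk p1 r1 by (auto simp: larger_left_def sv)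
      then show False using no_larger by simp
    qed
    have q_perm: "u \<circ> t \<circ> p permutes {1..Suc m}"
      using pp u_perm t_perm by (intro permutes_compose)
    have qv: "(u \<circ> t \<circ> p) 1 = 1" "(u \<circ> t \<circ> p) (Suc m) = Suc m"
      using m by (simp_all add: pn p1 tv uv)
    then have q: "u \<circ> t \<circ> p permutes {2..m}"
      using q_perm unfolding S by (metis permutes_insert_fixed)
    have "p m \<in> {2..<m}" using ri[of m] j p1 inj[of m 1] m by auto
    then have qm: "(u \<circ> t \<circ> p) m \<noteq> m" by (simp add: tv uv)
    have "t \<circ> u \<circ> (u \<circ> t \<circ> p) = (t \<circ> u) \<circ> (u \<circ> t) \<circ> p" by (simp only: o_assoc)
    then have "p = t \<circ> u \<circ> (u \<circ> t \<circ> p)" using inverse by simp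
    then show "u \<circ> t \<circ> p \<in> {q \<in> shallow_132 {2..m}. q m \<noteq> m}"
      using key(1,2)[OF q qm] ex av q qm by (simp add: shallow_132_def del: comp_apply)
  qed
qed

subsection \<open>Recurrences\<close>

lemma finite_shallow_132: "finite S \<Longrightarrow> finite (shallow_132 S)"
  unfolding shallow_132_def by (rule finite_subset[OF _ finite_permutations]) auto

text \<open>Inclusion-exclusion over the three cases. Only \<open>p 1 = n\<close> and
  \<open>p n = 1\<close> overlap, because the length is at least 2; the overlap is counted by
  removing both extremes. The additive form avoids subtraction.\<close>

lemma card_shallow_132_rec:
  "card (shallow_132 {1..Suc (Suc m)}) + card (shallow_132 {1..m}) =
    card (shallow_132 {1..Suc m}) + 2 * card {p \<in> shallow_132 {1..Suc (Suc m)}. p (Suc (Suc m)) = 1}"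
proof -
  let ?n = "Suc (Suc m)"
  let ?X = "shallow_132 {1..?n}"
  let ?A = "{p \<in> ?X. p ?n = ?n}" and ?B = "{p \<in> ?X. p 1 = ?n}" and ?C = "{p \<in> ?X. p ?n = 1}"
  have fin: "finite ?X" by (simp add: finite_shallow_132)
  have perm: "p permutes {1..?n}" if "p \<in> ?X" for p using that by (simp add: shallow_132_def)
  have disj: "?A \<inter> (?B \<union> ?C) = {}"
  proof -
    have "p 1 \<noteq> p ?n" if "p \<in> ?X" for p using permutes_inj[OF perm[OF that]] by (simp add: inj_eq One_nat_def)
    moreover have "?n \<noteq> 1" by (simp add: One_nat_def)
    ultimately show ?thesis by (intro equals0I) (elim IntE UnE CollectE conjE; metis)
  qed
  have "?X = ?A \<union> (?B \<union> ?C)" using shallow_132_cases[of _ ?n] by (auto simp: One_nat_def)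
  then have "card ?X = card ?A + card (?B \<union> ?C)"
    using card_Un_disjoint[OF _ _ disj] fin by (metis (no_types, lifting) finite_Un)
  moreover have "card (?B \<union> ?C) + card (?B \<inter> ?C) = card ?B + card ?C"
    using card_Un_Int[of ?B ?C] fin by simp
  moreover have "?B \<inter> ?C = {p \<in> ?X. p ?n = 1 \<and> p 1 = ?n}" by auto
  moreover have "card {p \<in> ?X. p ?n = 1 \<and> p 1 = ?n} = card (shallow_132 {2..Suc m})"
    by (rule card_shallow_132_first_max_last_min) (simp add: One_nat_def)
  moreover have "card (shallow_132 {2..Suc m}) = card (shallow_132 {1..m})"
    using card_shallow_132_shift[of 1 m] by (simp add: One_nat_def numeral_2_eq_2)
  moreover have "?A = shallow_132 {1..Suc m}"
    by (rule shallow_132_fixed_last) (simp add: One_nat_def)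
  moreover have "card ?B = card ?C" by (rule card_shallow_132_first_max)
  ultimately show ?thesis by simp
qed

text \<open>The maximum is first, last but one, or elsewhere; length at least 3 makes the first two
  cases exclusive.\<close>

lemma card_shallow_132_last_min_rec:
  "card {p \<in> shallow_132 {1..Suc (Suc (Suc m))}. p (Suc (Suc (Suc m))) = 1} + card (shallow_132 {1..m}) =
    2 * card (shallow_132 {1..Suc m}) + card {p \<in> shallow_132 {1..Suc (Suc m)}. p (Suc (Suc m)) = 1}"
proof -
  let ?m = "Suc (Suc m)"
  let ?n = "Suc ?m"
  let ?X = "shallow_132 {1..?n}" and ?Y = "shallow_132 {2..?m}"
  let ?A = "{p \<in> ?X. p ?n = 1 \<and> p 1 = ?n}" and ?B = "{p \<in> ?X. p ?n = 1 \<and> p ?m = ?n}"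
    and ?C = "{p \<in> ?X. p ?n = 1 \<and> p 1 \<noteq> ?n \<and> p ?m \<noteq> ?n}"
  have fin: "finite ?X" "finite ?Y" by (simp_all add: finite_shallow_132)
  have disj: "?A \<inter> ?B = {}"
  proof -
    have "p 1 \<noteq> p ?m" if "p \<in> ?X" for p
    proof -
      have "p permutes {1..?n}" using that by (simp add: shallow_132_def)
      then show ?thesis using permutes_inj[of p] by (simp add: inj_eq One_nat_def)
    qed
    then show ?thesis by (intro equals0I) (elim IntE CollectE conjE; metis)
  qed
  have "{p \<in> ?X. p ?n = 1} = (?A \<union> ?B) \<union> ?C" by auto
  moreover have "card ((?A \<union> ?B) \<union> ?C) = card (?A \<union> ?B) + card ?C"
    using fin by (intro card_Un_disjoint) auto
  moreover have "card (?A \<union> ?B) = card ?A + card ?B"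
    using fin disj by (intro card_Un_disjoint) auto
  moreover have "card ?A = card ?Y"
    by (rule card_shallow_132_first_max_last_min) (simp add: One_nat_def)
  moreover have "card ?B = card {q \<in> shallow_132 {1..?m}. q ?m = 1}"
    by (rule card_shallow_132_penultimate_max_last_min) (simp add: One_nat_def)
  moreover have "card ?C = card {q \<in> ?Y. q ?m \<noteq> ?m}"
    by (rule card_shallow_132_inner_max_last_min) simp
  \<comment> \<open>The third case is counted as a complement: all of \<open>?Y\<close> minus those
    fixing their maximum, which live on the next shorter interval.\<close>
  moreover have "card ?Y = card {q \<in> ?Y. q ?m \<noteq> ?m} + card {q \<in> ?Y. q ?m = ?m}"
    using fin by (subst card_Un_disjoint[symmetric]) (auto intro: arg_cong[where f = card])
  moreover have "{q \<in> ?Y. q ?m = ?m} = shallow_132 {2..Suc m}"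
    by (rule shallow_132_fixed_last) simp
  moreover have "card (shallow_132 {2..Suc m}) = card (shallow_132 {1..m})"
      "card ?Y = card (shallow_132 {1..Suc m})"
    using card_shallow_132_shift[of 1 m] card_shallow_132_shift[of 1 "Suc m"]
    by (simp_all add: One_nat_def numeral_2_eq_2)
  ultimately show ?thesis by simp
qed

lemma card_shallow_132_0: "card (shallow_132 {1..0}) = 1"
proof -
  have "shallow_132 {1..0} = {id}"
    by (auto simp: shallow_132_def excess_def inv_pairs_def avoids_132_def)
  then show ?thesis by simp
qed

lemma card_shallow_132_1: "card (shallow_132 {1..Suc 0}) = 1"
proof -
  have "p (Suc 0) = Suc 0" if "p \<in> shallow_132 {1..Suc 0}" for p
    using that shallow_132_cases[of p "Suc 0"] by (simp add: One_nat_def)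
  then have "shallow_132 {1..Suc 0} = {p \<in> shallow_132 {1..Suc 0}. p (Suc 0) = Suc 0}" by auto
  also have "\<dots> = shallow_132 {1..0}" by (rule shallow_132_fixed_last) (simp add: One_nat_def)
  finally show ?thesis using card_shallow_132_0 by simp
qed

lemma card_shallow_132_2_last_min:
  assumes n: "n = Suc 1"
  shows "card {p \<in> shallow_132 {1..n}. p n = 1} = 1"
proof -
  let ?X = "shallow_132 {1..n}"
  have "p 1 = n" if "p \<in> ?X" "p n = 1" for p
  proof -
    have p: "p permutes {1..n}" using that(1) by (simp add: shallow_132_def)
    have "p 1 \<noteq> p n" using permutes_inj[OF p] n by (simp add: inj_eq)
    then have "p 1 \<noteq> 1" using that(2) by simp
    moreover have "1 \<le> p 1" "p 1 \<le> n"
      using permutes_in_image[OF p, of 1] n by simp_all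
    ultimately show ?thesis using n by linarith
  qed
  then have "{p \<in> ?X. p n = 1} = {p \<in> ?X. p n = 1 \<and> p 1 = n}" by blast
  \<comment> \<open>Removing both entries leaves the empty interval, whose only permutation is the
    identity.\<close>
  also have "card \<dots> = card (shallow_132 {2..1})"
    unfolding n by (rule card_shallow_132_first_max_last_min) simp
  also have "\<dots> = 1" using card_shallow_132_shift[of 1 0] card_shallow_132_0
    by (simp only: One_nat_def numeral_2_eq_2)
  finally show ?thesis .
qed

text \<open>The recurrences reach two lengths back, so consecutive counts and the count with last
  entry 1 are carried together. The second conjunct is \<open>a_m = F_(2m-1)\<close> written without
  subtraction, which at \<open>m = 0\<close> reads \<open>a_0 = 1\<close>. Both new counts equal
  \<open>3 F_(2m+1) - F_(2m-1) = F_(2m+3)\<close>.\<close>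

lemma card_shallow_132_fib:
  "card (shallow_132 {1..Suc m}) = fib (2 * m + 1) \<and>
   card (shallow_132 {1..m}) + fib (2 * m) = fib (2 * m + 1) \<and>
   card {p \<in> shallow_132 {1..Suc (Suc m)}. p (Suc (Suc m)) = 1} = fib (2 * m + 1)"
proof (induction m)
  case 0
  then show ?case
    using card_shallow_132_0 card_shallow_132_1 card_shallow_132_2_last_min[of "Suc (Suc 0)"]
    by (simp add: One_nat_def)
next
  case (Suc m)
  have "fib (2 * Suc m) = fib (2 * m + 1) + fib (2 * m)"
    "fib (2 * Suc m + 1) = 2 * fib (2 * m + 1) + fib (2 * m)"
    by (simp_all add: One_nat_def)
  then show ?case
    using Suc card_shallow_132_rec[of m] card_shallow_132_last_min_rec[of m] by linarith
qed

subsection \<open>Pattern containment\<close>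

text \<open>Both directions of each comparison appear because the definition asks for an equivalence
  on every ordered pair of indices; the diagonal pairs hold trivially.\<close>

lemma contains_length_3:
  "contains n p [x, y, z] \<longleftrightarrow> (\<exists>i\<in>{1..n}. \<exists>j\<in>{1..n}. \<exists>k\<in>{1..n}. i < j \<and> j < k \<and>
    (p i < p j \<longleftrightarrow> x < y) \<and> (p j < p i \<longleftrightarrow> y < x) \<and> (p i < p k \<longleftrightarrow> x < z) \<and>
    (p k < p i \<longleftrightarrow> z < x) \<and> (p j < p k \<longleftrightarrow> y < z) \<and> (p k < p j \<longleftrightarrow> z < y))"
  (is "_ \<longleftrightarrow> (\<exists>i\<in>_. \<exists>j\<in>_. \<exists>k\<in>_. ?P i j k)")
proof
  let ?s = "[x, y, z]"
  assume "contains n p ?s"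
  then show "\<exists>i\<in>{1..n}. \<exists>j\<in>{1..n}. \<exists>k\<in>{1..n}. ?P i j k"
    unfolding contains_def
  proof (elim exE conjE)
    fix idx assume mono: "strict_mono_on {0..<length ?s} idx"
      and idx: "\<forall>a<length ?s. idx a \<in> {1..n}"
      and ord: "\<forall>a<length ?s. \<forall>b<length ?s. p (idx a) < p (idx b) \<longleftrightarrow> ?s ! a < ?s ! b"
    have ord': "p (idx a) < p (idx b) \<longleftrightarrow> ?s ! a < ?s ! b" if "a < 3" "b < 3" for a b
      using ord that by simp
    have "idx 0 < idx 1" "idx 1 < idx 2"
      by (rule strict_mono_onD[OF mono]; simp)+
    then have "?P (idx 0) (idx 1) (idx 2)"
      using ord'[of 0 1] ord'[of 1 0] ord'[of 0 2] ord'[of 2 0] ord'[of 1 2] ord'[of 2 1] by simp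
    moreover have "idx 0 \<in> {1..n}" "idx 1 \<in> {1..n}" "idx 2 \<in> {1..n}" using idx by simp_all
    ultimately show ?thesis by blast
  qed
next
  assume "\<exists>i\<in>{1..n}. \<exists>j\<in>{1..n}. \<exists>k\<in>{1..n}. ?P i j k"
  then show "contains n p [x, y, z]"
  proof (elim bexE)
    fix i j k assume ijk: "i \<in> {1..n}" "j \<in> {1..n}" "k \<in> {1..n}" "?P i j k"
    then have "strict_mono_on {0..<length [x, y, z]} (\<lambda>a. [i, j, k] ! a)"
      by (auto simp: strict_mono_on_def less_Suc_eq One_nat_def)
    then show ?thesis
      unfolding contains_def using ijk
      by (intro exI[of _ "\<lambda>a. [i, j, k] ! a"]) (simp add: All_less_Suc One_nat_def)
  qed
qed

lemma avoids_132_iff: "avoids n p [1, 3, 2] \<longleftrightarrow> avoids_132 {1..n} p"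
  unfolding avoids_def contains_length_3 avoids_132_def
  by (intro arg_cong[where f = Not] bex_cong refl) auto

lemma avoids_213_iff: "avoids n p [2, 1, 3] \<longleftrightarrow> avoids_213 {1..n} p"
  unfolding avoids_def contains_length_3 avoids_213_def
  by (intro arg_cong[where f = Not] bex_cong refl) auto

theorem theorem3p1:
  fixes n :: nat and sigma :: "nat list"
  assumes "n \<ge> 1"
    and "sigma \<in> {[1, 3, 2], [2, 1, 3]}"
  shows "card {p. p permutes {1..n} \<and> shallow n p \<and> avoids n p sigma} = fib (2 * n - 1)"
proof -
  obtain m where n: "n = Suc m" using assms(1) by (cases n) (auto simp: One_nat_def)
  \<comment> \<open>For 132 this is unfolding; for 213 it is the reverse-complement
    bijection.\<close>
  have "card {p. p permutes {1..n} \<and> shallow n p \<and> avoids n p sigma} = card (shallow_132 {1..n})"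
    using assms(2) card_shallow_213[of n]
    by (auto simp: shallow_iff_excess avoids_132_iff avoids_213_iff shallow_132_def)
  also have "\<dots> = fib (2 * m + 1)" using card_shallow_132_fib[of m] n by simp
  finally show ?thesis by (simp add: n One_nat_def)
qed

end
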